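(* Let $(\widetilde M^{2m+1},g,\varphi,\xi,\eta)$ be a Sasakian manifold. There do not exist $CRS$ bi-warped products $M=N_T\times_{f_1}N_\perp\times_{f_2}N_\theta$ in $\widetilde M^{2m+1}$ other than contact $CR$-biwarped products; that is, every $CRS$ bi-warped product in a Sasakian manifold is a contact $CR$-biwarped product.
   Context: An almost contact metric manifold $(\widetilde M^{2m+1},g,\varphi,\xi,\eta)$ is a Riemannian manifold with a $(1,1)$ tensor field $\varphi$, a vector field $\xi$ (the structure vector field) and a $1$-form $\eta$ satisfying $\varphi^2=-\mathrm{Id}+\eta\otimes\xi$, $\eta(\xi)=1$, $\varphi(\xi)=0$, $\eta\circ\varphi=0$, $g(\varphi X,\varphi Y)=g(X,Y)-\eta(X)\eta(Y)$, $\eta(X)=g(X,\xi)$. Let $\widetilde\nabla$ be its Levi-Civita connection. It is Sasakian iff $(\widetilde\nabla_X\varphi)Y=g(X,Y)\xi-\eta(Y)X$ and $\widetilde\nabla_X\xi=-\varphi X$ for all vector fields $X,Y$. A submanifold $N$ of $\widetilde M$ is invariant if it is tangent to $\xi$ and $\varphi(T_xN)\subseteq T_xN$ for all $x\in N$; anti-invariant if $\varphi(T_xN)\subset T_x^\perp N$ for all $x\in N$; pointwise slant if for every $x\in N$ and nonzero $X\in T_xN$ the angle between $\varphi X$ and $T_xN$ is independent of the choice of $X\in T_xN$ (it is then a function $\theta$ of the point, the slant function). Given Riemannian manifolds $(B,g_B),(N_1,g_1),(N_2,g_2)$ and positive smooth functions $f_1,f_2$ on $B$, the bi-warped product $B\times_{f_1}N_1\times_{f_2}N_2$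 is $B\times N_1\times N_2$ with metric $g_B+f_1^2g_1+f_2^2g_2$. A $CRS$ bi-warped product in $\widetilde M^{2m+1}$ is a submanifold which, with its induced metric, is a bi-warped product $N_T^{2p+1}\times_{f_1}N_\perp^{n_1}\times_{f_2}N_\theta^{n_2}$, where $N_T$ is an invariant submanifold tangent to $\xi$, $N_\perp$ is an anti-invariant submanifold, $N_\theta$ is a pointwise slant submanifold of $\widetilde M$ (the factors being identified with the corresponding leaves), and $f_1,f_2$ are positive smooth functions on $N_T$. It is a contact $CR$-biwarped product if it is of the form $N_T^{2p+1}\times_{f_1}N_\perp^{n_1}\times_{f_2}N_\perp^{n_2}$ with $N_T$ invariant and tangent to $\xi$ and both $N_\perp^{n_1}$ and $N_\perp^{n_2}$ anti-invariant. *)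

theory Defs
  imports "HOL-Analysis.Analysis"
begin

section \<open>Smooth manifolds\<close>

text \<open>Smoothness of maps between normed spaces; \<open>S\<close> is an open set in all uses, and the domain is
  finite-dimensional, so that \<open>Ck_on k\<close> is the usual class $C^k$.\<close>

primrec Ck_on :: "nat \<Rightarrow> 'e::real_normed_vector set \<Rightarrow> ('e \<Rightarrow> 'f::real_normed_vector) \<Rightarrow> bool" where
  "Ck_on 0 S f \<longleftrightarrow> continuous_on S f"
| "Ck_on (Suc k) S f \<longleftrightarrow>
     (\<forall>x\<in>S. f differentiable (at x)) \<and> (\<forall>v. Ck_on k S (\<lambda>x. frechet_derivative f (at x) v))"

definition smooth_on :: "'e::real_normed_vector set \<Rightarrow> ('e \<Rightarrow> 'f::real_normed_vector) \<Rightarrow> bool" where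
  "smooth_on S f \<longleftrightarrow> (\<forall>k. Ck_on k S f)"

text \<open>A chart is a pair of its domain and its coordinate map. A manifold is a whole type \<open>'a\<close>
  (Hausdorff and second countable) together with a smooth atlas \<open>A\<close>; its dimension is \<open>DIM('e)\<close>.\<close>

type_synonym ('a, 'e) chart = "'a set \<times> ('a \<Rightarrow> 'e)"
type_synonym ('a, 'e) atlas = "('a, 'e) chart set"

definition is_chart :: "('a::topological_space, 'e::euclidean_space) chart \<Rightarrow> bool" where
  "is_chart c \<longleftrightarrow> open (fst c) \<and> open (snd c ` fst c) \<and>
     (\<exists>k. homeomorphism (fst c) (snd c ` fst c) (snd c) k)"

definition chart_inv :: "('a, 'e) chart \<Rightarrow> 'e \<Rightarrow> 'a" where
  "chart_inv c = inv_into (fst c) (snd c)"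

definition smooth_manifold ::
  "('a::{t2_space, second_countable_topology}, 'e::euclidean_space) atlas \<Rightarrow> bool" where
  "smooth_manifold A \<longleftrightarrow>
     (\<forall>c\<in>A. is_chart c) \<and>
     (\<Union>c\<in>A. fst c) = UNIV \<and>
     (\<forall>c\<in>A. \<forall>d\<in>A. smooth_on (snd c ` (fst c \<inter> fst d)) (snd d \<circ> chart_inv c))"

definition real_line :: "(real, real) atlas" where
  "real_line = {(UNIV, id)}"

definition prod_atlas :: "('a, 'e) atlas \<Rightarrow> ('b, 'f) atlas \<Rightarrow> ('a \<times> 'b, 'e \<times> 'f) atlas" where
  "prod_atlas A B = (\<lambda>(c, d). (fst c \<times> fst d, map_prod (snd c) (snd d))) ` (A \<times> B)"

definition smooth_near :: "('a::topological_space, 'e::euclidean_space) atlas \<Rightarrow>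
    ('b, 'f::euclidean_space) atlas \<Rightarrow> ('a \<Rightarrow> 'b) \<Rightarrow> 'a \<Rightarrow> bool" where
  "smooth_near A B F p \<longleftrightarrow>
     (\<exists>c\<in>A. \<exists>d\<in>B. \<exists>W. open W \<and> p \<in> W \<and> W \<subseteq> fst c \<and> F ` W \<subseteq> fst d \<and>
        smooth_on (snd c ` W) (snd d \<circ> F \<circ> chart_inv c))"

definition smooth_map :: "('a::topological_space, 'e::euclidean_space) atlas \<Rightarrow>
    ('b, 'f::euclidean_space) atlas \<Rightarrow> ('a \<Rightarrow> 'b) \<Rightarrow> bool" where
  "smooth_map A B F \<longleftrightarrow> (\<forall>p. smooth_near A B F p)"

abbreviation smooth_fun :: "('a::topological_space, 'e::euclidean_space) atlas \<Rightarrow> ('a \<Rightarrow> real) \<Rightarrow> bool" where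
  "smooth_fun A f \<equiv> smooth_map A real_line f"

section \<open>Tangent vectors and vector fields\<close>

text \<open>A tangent vector at \<open>p\<close> is the velocity of a smooth curve \<open>\<gamma>\<close> through \<open>p\<close>, that is, the operator
  $f \mapsto (f \circ \gamma)'(0)$ on the functions that are smooth near \<open>p\<close>. The value 0 on all other
  functions makes two tangent vectors at \<open>p\<close> equal as soon as they agree on the functions smooth near \<open>p\<close>.\<close>

type_synonym 'a tvec = "('a \<Rightarrow> real) \<Rightarrow> real"
type_synonym 'a vfield = "'a \<Rightarrow> 'a tvec"

definition tangent_space :: "('a::topological_space, 'e::euclidean_space) atlas \<Rightarrow> 'a \<Rightarrow> 'a tvec set" where
  "tangent_space A p =
     {v. \<exists>\<gamma>. smooth_near real_line A \<gamma> 0 \<and> \<gamma> 0 = p \<and>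
          v = (\<lambda>f. if smooth_near A real_line f p then deriv (\<lambda>t. f (\<gamma> t)) 0 else 0)}"

definition tzero :: "'a tvec" where
  "tzero = (\<lambda>f. 0)"

definition lincomb :: "real \<Rightarrow> 'a tvec \<Rightarrow> real \<Rightarrow> 'a tvec \<Rightarrow> 'a tvec" where
  "lincomb a u b v = (\<lambda>f. a * u f + b * v f)"

text \<open>The differential at \<open>p\<close> of a smooth map \<open>F\<close> from \<open>A\<close> to \<open>B\<close>.\<close>

definition differential :: "('a::topological_space, 'e::euclidean_space) atlas \<Rightarrow>
    ('b::topological_space, 'f::euclidean_space) atlas \<Rightarrow> ('a \<Rightarrow> 'b) \<Rightarrow> 'a \<Rightarrow> 'a tvec \<Rightarrow> 'b tvec" where
  "differential A B F p v = (\<lambda>f. if smooth_near B real_line f (F p) then v (f \<circ> F) else 0)"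

definition vector_field :: "('a::topological_space, 'e::euclidean_space) atlas \<Rightarrow> 'a vfield \<Rightarrow> bool" where
  "vector_field A X \<longleftrightarrow> (\<forall>p. X p \<in> tangent_space A p) \<and>
     (\<forall>f. smooth_fun A f \<longrightarrow> smooth_fun A (\<lambda>p. X p f))"

definition lie_bracket :: "('a::topological_space, 'e::euclidean_space) atlas \<Rightarrow>
    'a vfield \<Rightarrow> 'a vfield \<Rightarrow> 'a vfield" where
  "lie_bracket A X Y p = (\<lambda>f. if smooth_near A real_line f p
     then X p (\<lambda>q. Y q f) - Y p (\<lambda>q. X q f) else 0)"

section \<open>Riemannian manifolds and the Levi-Civita connection\<close>

type_synonym 'a metric = "'a \<Rightarrow> 'a tvec \<Rightarrow> 'a tvec \<Rightarrow> real"

definition riemannian_manifold ::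
  "('a::{t2_space, second_countable_topology}, 'e::euclidean_space) atlas \<Rightarrow> 'a metric \<Rightarrow> bool" where
  "riemannian_manifold A g \<longleftrightarrow>
     smooth_manifold A \<and>
     (\<forall>p. \<forall>u\<in>tangent_space A p. \<forall>v\<in>tangent_space A p. g p u v = g p v u) \<and>
     (\<forall>p a b. \<forall>u\<in>tangent_space A p. \<forall>v\<in>tangent_space A p. \<forall>w\<in>tangent_space A p.
        g p (lincomb a u b v) w = a * g p u w + b * g p v w) \<and>
     (\<forall>p. \<forall>u\<in>tangent_space A p. u \<noteq> tzero \<longrightarrow> g p u u > 0) \<and>
     (\<forall>X Y. vector_field A X \<and> vector_field A Y \<longrightarrow> smooth_fun A (\<lambda>p. g p (X p) (Y p)))"

definition affine_connection :: "('a::topological_space, 'e::euclidean_space) atlas \<Rightarrow>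
    ('a vfield \<Rightarrow> 'a vfield \<Rightarrow> 'a vfield) \<Rightarrow> bool" where
  "affine_connection A D \<longleftrightarrow>
     (\<forall>X Y. vector_field A X \<and> vector_field A Y \<longrightarrow> vector_field A (D X Y)) \<and>
     (\<forall>X X' Y f h. vector_field A X \<and> vector_field A X' \<and> vector_field A Y \<and>
          smooth_fun A f \<and> smooth_fun A h \<longrightarrow>
        (\<forall>p. D (\<lambda>q. lincomb (f q) (X q) (h q) (X' q)) Y p = lincomb (f p) (D X Y p) (h p) (D X' Y p))) \<and>
     (\<forall>X Y Y'. vector_field A X \<and> vector_field A Y \<and> vector_field A Y' \<longrightarrow>
        (\<forall>p. D X (\<lambda>q. lincomb 1 (Y q) 1 (Y' q)) p = lincomb 1 (D X Y p) 1 (D X Y' p))) \<and>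
     (\<forall>X Y f. vector_field A X \<and> vector_field A Y \<and> smooth_fun A f \<longrightarrow>
        (\<forall>p. D X (\<lambda>q. lincomb (f q) (Y q) 0 tzero) p = lincomb (X p f) (Y p) (f p) (D X Y p)))"

definition levi_civita_connection :: "('a::topological_space, 'e::euclidean_space) atlas \<Rightarrow>
    'a metric \<Rightarrow> ('a vfield \<Rightarrow> 'a vfield \<Rightarrow> 'a vfield) \<Rightarrow> bool" where
  "levi_civita_connection A g D \<longleftrightarrow>
     affine_connection A D \<and>
     (\<forall>X Y. vector_field A X \<and> vector_field A Y \<longrightarrow>
        (\<forall>p. lincomb 1 (D X Y p) (- 1) (D Y X p) = lie_bracket A X Y p)) \<and>
     (\<forall>X Y Z. vector_field A X \<and> vector_field A Y \<and> vector_field A Z \<longrightarrow>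
        (\<forall>p. X p (\<lambda>q. g q (Y q) (Z q)) = g p (D X Y p) (Z p) + g p (Y p) (D X Z p)))"

section \<open>Almost contact metric and Sasakian manifolds\<close>

definition one_form :: "('a::topological_space, 'e::euclidean_space) atlas \<Rightarrow>
    ('a \<Rightarrow> 'a tvec \<Rightarrow> real) \<Rightarrow> bool" where
  "one_form A \<omega> \<longleftrightarrow>
     (\<forall>p a b. \<forall>u\<in>tangent_space A p. \<forall>v\<in>tangent_space A p.
        \<omega> p (lincomb a u b v) = a * \<omega> p u + b * \<omega> p v) \<and>
     (\<forall>X. vector_field A X \<longrightarrow> smooth_fun A (\<lambda>p. \<omega> p (X p)))"

definition tensor_field_1_1 :: "('a::topological_space, 'e::euclidean_space) atlas \<Rightarrow>
    ('a \<Rightarrow> 'a tvec \<Rightarrow> 'a tvec) \<Rightarrow> bool" where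
  "tensor_field_1_1 A \<phi> \<longleftrightarrow>
     (\<forall>p. \<forall>u\<in>tangent_space A p. \<phi> p u \<in> tangent_space A p) \<and>
     (\<forall>p a b. \<forall>u\<in>tangent_space A p. \<forall>v\<in>tangent_space A p.
        \<phi> p (lincomb a u b v) = lincomb a (\<phi> p u) b (\<phi> p v)) \<and>
     (\<forall>X. vector_field A X \<longrightarrow> vector_field A (\<lambda>p. \<phi> p (X p)))"

definition almost_contact_metric_manifold ::
  "('a::{t2_space, second_countable_topology}, 'e::euclidean_space) atlas \<Rightarrow> 'a metric \<Rightarrow>
    ('a \<Rightarrow> 'a tvec \<Rightarrow> 'a tvec) \<Rightarrow> 'a vfield \<Rightarrow> ('a \<Rightarrow> 'a tvec \<Rightarrow> real) \<Rightarrow> bool" where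
  "almost_contact_metric_manifold A g \<phi> \<xi> \<eta> \<longleftrightarrow>
     (\<exists>m. DIM('e) = 2 * m + 1) \<and>
     riemannian_manifold A g \<and> tensor_field_1_1 A \<phi> \<and> vector_field A \<xi> \<and> one_form A \<eta> \<and>
     (\<forall>p. \<forall>u\<in>tangent_space A p. \<phi> p (\<phi> p u) = lincomb (- 1) u (\<eta> p u) (\<xi> p)) \<and>
     (\<forall>p. \<eta> p (\<xi> p) = 1) \<and>
     (\<forall>p. \<phi> p (\<xi> p) = tzero) \<and>
     (\<forall>p. \<forall>u\<in>tangent_space A p. \<eta> p (\<phi> p u) = 0) \<and>
     (\<forall>p. \<forall>u\<in>tangent_space A p. \<forall>v\<in>tangent_space A p.
        g p (\<phi> p u) (\<phi> p v) = g p u v - \<eta> p u * \<eta> p v) \<and>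
     (\<forall>p. \<forall>u\<in>tangent_space A p. \<eta> p u = g p u (\<xi> p))"

text \<open>The first condition on \<open>D\<close> is $(\nabla_X \varphi) Y = g(X,Y)\xi - \eta(Y) X$ with
  $(\nabla_X \varphi) Y = \nabla_X (\varphi Y) - \varphi (\nabla_X Y)$, the second one is
  $\nabla_X \xi = -\varphi X$.\<close>

definition sasakian_manifold ::
  "('a::{t2_space, second_countable_topology}, 'e::euclidean_space) atlas \<Rightarrow> 'a metric \<Rightarrow>
    ('a \<Rightarrow> 'a tvec \<Rightarrow> 'a tvec) \<Rightarrow> 'a vfield \<Rightarrow> ('a \<Rightarrow> 'a tvec \<Rightarrow> real) \<Rightarrow> bool" where
  "sasakian_manifold A g \<phi> \<xi> \<eta> \<longleftrightarrow>
     almost_contact_metric_manifold A g \<phi> \<xi> \<eta> \<and>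
     (\<exists>D. levi_civita_connection A g D \<and>
        (\<forall>X Y. vector_field A X \<and> vector_field A Y \<longrightarrow>
           (\<forall>p. lincomb 1 (D X (\<lambda>q. \<phi> q (Y q)) p) (- 1) (\<phi> p (D X Y p))
                 = lincomb (g p (X p) (Y p)) (\<xi> p) (- \<eta> p (Y p)) (X p))) \<and>
        (\<forall>X. vector_field A X \<longrightarrow> (\<forall>p. D X \<xi> p = lincomb (- 1) (\<phi> p (X p)) 0 tzero)))"

section \<open>Submanifolds\<close>

text \<open>A submanifold is given by an immersion \<open>\<iota>\<close> of a manifold \<open>N\<close>; its tangent space at \<open>x\<close> is
  then a subspace of the tangent space of the ambient manifold \<open>A\<close> at \<open>\<iota> x\<close>.\<close>

definition immersion :: "('b::topological_space, 'f::euclidean_space) atlas \<Rightarrow>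
    ('a::topological_space, 'e::euclidean_space) atlas \<Rightarrow> ('b \<Rightarrow> 'a) \<Rightarrow> bool" where
  "immersion N A \<iota> \<longleftrightarrow> smooth_map N A \<iota> \<and> (\<forall>x. inj_on (differential N A \<iota> x) (tangent_space N x))"

definition sub_tangent_space :: "('b::topological_space, 'f::euclidean_space) atlas \<Rightarrow>
    ('a::topological_space, 'e::euclidean_space) atlas \<Rightarrow> ('b \<Rightarrow> 'a) \<Rightarrow> 'b \<Rightarrow> 'a tvec set" where
  "sub_tangent_space N A \<iota> x = differential N A \<iota> x ` tangent_space N x"

definition sub_normal_space :: "('b::topological_space, 'f::euclidean_space) atlas \<Rightarrow>
    ('a::topological_space, 'e::euclidean_space) atlas \<Rightarrow> 'a metric \<Rightarrow> ('b \<Rightarrow> 'a) \<Rightarrow> 'b \<Rightarrow> 'a tvec set" where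
  "sub_normal_space N A g \<iota> x =
     {w \<in> tangent_space A (\<iota> x). \<forall>u\<in>sub_tangent_space N A \<iota> x. g (\<iota> x) w u = 0}"

definition induced_metric :: "('b::topological_space, 'f::euclidean_space) atlas \<Rightarrow>
    ('a::topological_space, 'e::euclidean_space) atlas \<Rightarrow> 'a metric \<Rightarrow> ('b \<Rightarrow> 'a) \<Rightarrow> 'b metric" where
  "induced_metric N A g \<iota> x u v = g (\<iota> x) (differential N A \<iota> x u) (differential N A \<iota> x v)"

definition invariant_submanifold :: "('b::topological_space, 'f::euclidean_space) atlas \<Rightarrow>
    ('a::topological_space, 'e::euclidean_space) atlas \<Rightarrow> ('a \<Rightarrow> 'a tvec \<Rightarrow> 'a tvec) \<Rightarrow> 'a vfield \<Rightarrow>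
    ('b \<Rightarrow> 'a) \<Rightarrow> bool" where
  "invariant_submanifold N A \<phi> \<xi> \<iota> \<longleftrightarrow> immersion N A \<iota> \<and>
     (\<forall>x. \<xi> (\<iota> x) \<in> sub_tangent_space N A \<iota> x \<and>
        \<phi> (\<iota> x) ` sub_tangent_space N A \<iota> x \<subseteq> sub_tangent_space N A \<iota> x)"

definition anti_invariant_submanifold :: "('b::topological_space, 'f::euclidean_space) atlas \<Rightarrow>
    ('a::topological_space, 'e::euclidean_space) atlas \<Rightarrow> 'a metric \<Rightarrow> ('a \<Rightarrow> 'a tvec \<Rightarrow> 'a tvec) \<Rightarrow>
    ('b \<Rightarrow> 'a) \<Rightarrow> bool" where
  "anti_invariant_submanifold N A g \<phi> \<iota> \<longleftrightarrow> immersion N A \<iota> \<and>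
     (\<forall>x. \<phi> (\<iota> x) ` sub_tangent_space N A \<iota> x \<subseteq> sub_normal_space N A g \<iota> x)"

text \<open>The angle at \<open>p\<close> between a nonzero tangent vector \<open>w\<close> and a nonzero subspace \<open>V\<close> is the smallest
  angle between \<open>w\<close> and a nonzero vector of \<open>V\<close>; it lies in $[0,\pi/2]$.\<close>

definition angle_to_subspace :: "'a metric \<Rightarrow> 'a \<Rightarrow> 'a tvec \<Rightarrow> 'a tvec set \<Rightarrow> real" where
  "angle_to_subspace g p w V =
     Inf ((\<lambda>u. arccos (g p w u / (sqrt (g p w w) * sqrt (g p u u)))) ` (V - {tzero}))"

text \<open>The angle is only defined where \<open>\<phi> X\<close> does not vanish, whence the restriction to such \<open>X\<close>;
  it excludes nothing but multiples of \<open>\<xi>\<close>.\<close>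

definition pointwise_slant_submanifold :: "('b::topological_space, 'f::euclidean_space) atlas \<Rightarrow>
    ('a::topological_space, 'e::euclidean_space) atlas \<Rightarrow> 'a metric \<Rightarrow> ('a \<Rightarrow> 'a tvec \<Rightarrow> 'a tvec) \<Rightarrow>
    ('b \<Rightarrow> 'a) \<Rightarrow> bool" where
  "pointwise_slant_submanifold N A g \<phi> \<iota> \<longleftrightarrow> immersion N A \<iota> \<and>
     (\<exists>\<theta>. \<forall>x. \<forall>X\<in>sub_tangent_space N A \<iota> x. X \<noteq> tzero \<and> \<phi> (\<iota> x) X \<noteq> tzero \<longrightarrow>
        angle_to_subspace g (\<iota> x) (\<phi> (\<iota> x) X) (sub_tangent_space N A \<iota> x) = \<theta> x)"

section \<open>Bi-warped product submanifolds\<close>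

abbreviation prod3_atlas :: "('b, 'eb) atlas \<Rightarrow> ('c, 'ec) atlas \<Rightarrow> ('d, 'ed) atlas \<Rightarrow>
    ('b \<times> 'c \<times> 'd, 'eb \<times> 'ec \<times> 'ed) atlas" where
  "prod3_atlas B N1 N2 \<equiv> prod_atlas B (prod_atlas N1 N2)"

definition biwarped_metric ::
  "('b::topological_space, 'eb::euclidean_space) atlas \<Rightarrow> 'b metric \<Rightarrow>
   ('c::topological_space, 'ec::euclidean_space) atlas \<Rightarrow> 'c metric \<Rightarrow>
   ('d::topological_space, 'ed::euclidean_space) atlas \<Rightarrow> 'd metric \<Rightarrow>
   ('b \<Rightarrow> real) \<Rightarrow> ('b \<Rightarrow> real) \<Rightarrow> ('b \<times> 'c \<times> 'd) metric" where
  "biwarped_metric B gB N1 g1 N2 g2 f1 f2 = (\<lambda>(x, y, z) u v.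
     (let P = prod3_atlas B N1 N2;
          dB = differential P B fst (x, y, z);
          d1 = differential P N1 (fst \<circ> snd) (x, y, z);
          d2 = differential P N2 (snd \<circ> snd) (x, y, z)
      in gB x (dB u) (dB v) + (f1 x)^2 * g1 y (d1 u) (d1 v) + (f2 x)^2 * g2 z (d2 u) (d2 v)))"

text \<open>\<open>\<iota>\<close> realises $B \times_{f_1} N_1 \times_{f_2} N_2$ as a submanifold of \<open>A\<close>, with the bi-warped
  product metric as induced metric.\<close>

definition biwarped_product_submanifold ::
  "('a::{t2_space, second_countable_topology}, 'e::euclidean_space) atlas \<Rightarrow> 'a metric \<Rightarrow>
   ('b::{t2_space, second_countable_topology}, 'eb::euclidean_space) atlas \<Rightarrow> 'b metric \<Rightarrow>
   ('c::{t2_space, second_countable_topology}, 'ec::euclidean_space) atlas \<Rightarrow> 'c metric \<Rightarrow>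
   ('d::{t2_space, second_countable_topology}, 'ed::euclidean_space) atlas \<Rightarrow> 'd metric \<Rightarrow>
   ('b \<Rightarrow> real) \<Rightarrow> ('b \<Rightarrow> real) \<Rightarrow> ('b \<times> 'c \<times> 'd \<Rightarrow> 'a) \<Rightarrow> bool" where
  "biwarped_product_submanifold A g B gB N1 g1 N2 g2 f1 f2 \<iota> \<longleftrightarrow>
     riemannian_manifold B gB \<and> riemannian_manifold N1 g1 \<and> riemannian_manifold N2 g2 \<and>
     smooth_fun B f1 \<and> (\<forall>x. f1 x > 0) \<and> smooth_fun B f2 \<and> (\<forall>x. f2 x > 0) \<and>
     immersion (prod3_atlas B N1 N2) A \<iota> \<and>
     (\<forall>x. \<forall>u\<in>tangent_space (prod3_atlas B N1 N2) x. \<forall>v\<in>tangent_space (prod3_atlas B N1 N2) x.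
        induced_metric (prod3_atlas B N1 N2) A g \<iota> x u v = biwarped_metric B gB N1 g1 N2 g2 f1 f2 x u v)"

text \<open>The factors are identified with the leaves of the product through its points, so the conditions
  on a factor are imposed on each of its leaves.\<close>

definition CRS_biwarped_product ::
  "('a::{t2_space, second_countable_topology}, 'e::euclidean_space) atlas \<Rightarrow> 'a metric \<Rightarrow>
   ('a \<Rightarrow> 'a tvec \<Rightarrow> 'a tvec) \<Rightarrow> 'a vfield \<Rightarrow>
   ('b::{t2_space, second_countable_topology}, 'eb::euclidean_space) atlas \<Rightarrow> 'b metric \<Rightarrow>
   ('c::{t2_space, second_countable_topology}, 'ec::euclidean_space) atlas \<Rightarrow> 'c metric \<Rightarrow>
   ('d::{t2_space, second_countable_topology}, 'ed::euclidean_space) atlas \<Rightarrow> 'd metric \<Rightarrow>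
   ('b \<Rightarrow> real) \<Rightarrow> ('b \<Rightarrow> real) \<Rightarrow> ('b \<times> 'c \<times> 'd \<Rightarrow> 'a) \<Rightarrow> bool" where
  "CRS_biwarped_product A g \<phi> \<xi> NT gT N1 g1 N2 g2 f1 f2 \<iota> \<longleftrightarrow>
     (\<exists>p. DIM('eb) = 2 * p + 1) \<and>
     biwarped_product_submanifold A g NT gT N1 g1 N2 g2 f1 f2 \<iota> \<and>
     (\<forall>y z. invariant_submanifold NT A \<phi> \<xi> (\<lambda>x. \<iota> (x, y, z))) \<and>
     (\<forall>x z. anti_invariant_submanifold N1 A g \<phi> (\<lambda>y. \<iota> (x, y, z))) \<and>
     (\<forall>x y. pointwise_slant_submanifold N2 A g \<phi> (\<lambda>z. \<iota> (x, y, z)))"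

definition contact_CR_biwarped_product ::
  "('a::{t2_space, second_countable_topology}, 'e::euclidean_space) atlas \<Rightarrow> 'a metric \<Rightarrow>
   ('a \<Rightarrow> 'a tvec \<Rightarrow> 'a tvec) \<Rightarrow> 'a vfield \<Rightarrow>
   ('b::{t2_space, second_countable_topology}, 'eb::euclidean_space) atlas \<Rightarrow> 'b metric \<Rightarrow>
   ('c::{t2_space, second_countable_topology}, 'ec::euclidean_space) atlas \<Rightarrow> 'c metric \<Rightarrow>
   ('d::{t2_space, second_countable_topology}, 'ed::euclidean_space) atlas \<Rightarrow> 'd metric \<Rightarrow>
   ('b \<Rightarrow> real) \<Rightarrow> ('b \<Rightarrow> real) \<Rightarrow> ('b \<times> 'c \<times> 'd \<Rightarrow> 'a) \<Rightarrow> bool" where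
  "contact_CR_biwarped_product A g \<phi> \<xi> NT gT N1 g1 N2 g2 f1 f2 \<iota> \<longleftrightarrow>
     (\<exists>p. DIM('eb) = 2 * p + 1) \<and>
     biwarped_product_submanifold A g NT gT N1 g1 N2 g2 f1 f2 \<iota> \<and>
     (\<forall>y z. invariant_submanifold NT A \<phi> \<xi> (\<lambda>x. \<iota> (x, y, z))) \<and>
     (\<forall>x z. anti_invariant_submanifold N1 A g \<phi> (\<lambda>y. \<iota> (x, y, z))) \<and>
     (\<forall>x y. anti_invariant_submanifold N2 A g \<phi> (\<lambda>z. \<iota> (x, y, z)))"

end

theory Submission
  imports Defs "HOL-Computational_Algebra.Polynomial"
begin

text \<open>
  Why the theorem holds. The leaves of $N_T$ are tangent to $\xi$, and the leaves of $N_\theta$ are orthogonal to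
  those of $N_T$, because the metric of a bi-warped product has no mixed terms
  (\<open>biwarped_leaves_orthogonal\<close>). Hence $\eta = g(\cdot,\xi)$ vanishes on every leaf of $N_\theta$, and so does
  the restriction of $d\eta$ to that leaf. On a Sasakian manifold $\nabla_X\xi = -\varphi X$ gives
  $d\eta(X,Y) = -2 g(\varphi X, Y)$ (\<open>sasakian_contact_form_derivative\<close>), so $g(\varphi Z, W) = 0$ for all $Z, W$
  tangent to the leaf (\<open>sasakian_integral_submanifold_anti_invariant\<close>). The leaves of $N_\theta$ are therefore
  anti-invariant, which is what distinguishes a contact $CR$-biwarped product.

  The same conclusion can be read off the warped product geometry of $M$: the part of
  $\nabla_Z\xi = -\varphi Z$ tangent to the leaf is $\xi(\ln f_2) Z$, and $g(\varphi Z, W)$ is skew in $Z, W$ whereas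
  $\xi(\ln f_2) g(Z,W)$ is symmetric. The argument through $d\eta$ avoids the second fundamental form.

  Most of the text supplies the foundations: a calculus of the smooth maps \<open>smooth_on\<close>, with composition and the
  symmetry of second derivatives; bump functions, because the Levi-Civita connection is an operation on global
  vector fields whereas the argument takes place in one chart; the description of tangent vectors by their
  coordinates; and products of manifolds.
\<close>

section \<open>Calculus of smooth maps between normed spaces\<close>

lemma Ck_on_subset:
  assumes "Ck_on k S f" "T \<subseteq> S"
  shows "Ck_on k T f"
  using assms
proof (induction k arbitrary: f)
  case 0
  then show ?case by (auto intro: continuous_on_subset)
next
  case (Suc k)
  then show ?case by (auto simp: subset_eq)
qed

text \<open>A function that is changed only outside the open set \<open>S\<close> keeps its Frechet derivatives on \<open>S\<close>.
  This lets every later argument replace a function by a formula that is valid near the point only.\<close>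

lemma Ck_on_cong:
  assumes "open S" "Ck_on k S f" "\<And>x. x \<in> S \<Longrightarrow> f x = h x"
  shows "Ck_on k S h"
  using assms(2,3)
proof (induction k arbitrary: f h)
  case 0
  then show ?case using continuous_on_eq[of S f h] by simp
next
  case (Suc k)
  have d: "(h has_derivative frechet_derivative f (at x)) (at x)" if "x \<in> S" for x
  proof (rule has_derivative_transform_within_open[OF _ assms(1) that])
    show "(f has_derivative frechet_derivative f (at x)) (at x)"
      using Suc.prems(1) that by (simp add: frechet_derivative_works)
  qed (rule Suc.prems(2))
  have eq: "frechet_derivative f (at x) = frechet_derivative h (at x)" if "x \<in> S" for x
    using frechet_derivative_at[OF d[OF that]] .
  have "Ck_on k S (\<lambda>x. frechet_derivative h (at x) v)" for v
    by (rule Suc.IH[of "\<lambda>x. frechet_derivative f (at x) v"]) (use Suc.prems eq in auto)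
  then show ?case
    using d by (auto simp: differentiable_def)
qed

lemma Ck_on_SucI:
  assumes "open S" "\<And>x. x \<in> S \<Longrightarrow> (f has_derivative f' x) (at x)"
    and "\<And>v. Ck_on k S (\<lambda>x. f' x v)"
  shows "Ck_on (Suc k) S f"
proof -
  have "f' x = frechet_derivative f (at x)" if "x \<in> S" for x
    using frechet_derivative_at[OF assms(2)[OF that]] .
  then have "Ck_on k S (\<lambda>x. frechet_derivative f (at x) v)" for v
    by (intro Ck_on_cong[OF assms(1,3)]) auto
  then show ?thesis
    using assms(2) by (auto simp: differentiable_def)
qed

lemma Ck_on_Suc_has_derivative:
  assumes "Ck_on (Suc k) S f" "x \<in> S"
  shows "(f has_derivative frechet_derivative f (at x)) (at x)"
  using assms by (simp add: frechet_derivative_works)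

lemma Ck_on_Suc_imp:
  assumes "Ck_on (Suc k) S f"
  shows "Ck_on k S f"
  using assms
proof (induction k arbitrary: f)
  case 0
  then show ?case
    by (auto intro!: continuous_at_imp_continuous_on differentiable_imp_continuous_within)
next
  case (Suc k)
  have "Ck_on k S (\<lambda>x. frechet_derivative f (at x) v)" for v
    by (rule Suc.IH) (use Suc.prems in auto)
  then show ?case using Suc.prems by auto
qed

lemma Ck_on_const: "open S \<Longrightarrow> Ck_on k S (\<lambda>x. c)"
proof (induction k arbitrary: c)
  case (Suc k)
  show ?case
    by (rule Ck_on_SucI[where f' = "\<lambda>_ _. 0"]) (use Suc in auto)
qed auto

lemma Ck_on_id: "open S \<Longrightarrow> Ck_on k S (\<lambda>x. x)"
proof (cases k)
  case (Suc j)
  assume "open S"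
  then show ?thesis unfolding Suc
    by (intro Ck_on_SucI[where f' = "\<lambda>_ v. v"]) (auto intro: Ck_on_const)
qed auto

lemma Ck_on_bounded_linear:
  assumes "open S" "bounded_linear L" "Ck_on k S f"
  shows "Ck_on k S (\<lambda>x. L (f x))"
  using assms(3)
proof (induction k arbitrary: f)
  case 0
  then show ?case by (auto intro: bounded_linear.continuous_on[OF assms(2)])
next
  case (Suc k)
  show ?case
    by (rule Ck_on_SucI[where f' = "\<lambda>x v. L (frechet_derivative f (at x) v)"])
       (use Suc assms in \<open>auto intro!: bounded_linear.has_derivative[OF assms(2)]
          Ck_on_Suc_has_derivative[OF Suc.prems]\<close>)
qed

lemma Ck_on_add:
  assumes "open S" "Ck_on k S f" "Ck_on k S h"
  shows "Ck_on k S (\<lambda>x. f x + h x)"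
  using assms(2,3)
proof (induction k arbitrary: f h)
  case 0
  then show ?case by (auto intro: continuous_on_add)
next
  case (Suc k)
  show ?case
    by (rule Ck_on_SucI[where f' = "\<lambda>x v. frechet_derivative f (at x) v + frechet_derivative h (at x) v"])
       (use Suc assms in \<open>auto intro!: has_derivative_add
          Ck_on_Suc_has_derivative[OF Suc.prems(1)] Ck_on_Suc_has_derivative[OF Suc.prems(2)]\<close>)
qed

lemma Ck_on_sum:
  assumes "open S" "\<And>i. i \<in> I \<Longrightarrow> Ck_on k S (f i)"
  shows "Ck_on k S (\<lambda>x. \<Sum>i\<in>I. f i x)"
  using assms(2)
  by (induction I rule: infinite_finite_induct) (auto intro: Ck_on_const Ck_on_add assms(1))

text \<open>In the induction both factors appear undifferentiated in the Leibniz rule, so the step needs that a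
  map of class \<open>Suc k\<close> is also of class \<open>k\<close>.\<close>

lemma Ck_on_scaleR:
  fixes f :: "'e::real_normed_vector \<Rightarrow> 'f::real_normed_vector"
  assumes "open S" "Ck_on k S a" "Ck_on k S f"
  shows "Ck_on k S (\<lambda>x. a x *\<^sub>R f x)"
  using assms(2,3)
proof (induction k arbitrary: a f)
  case 0
  then show ?case by (auto intro: continuous_on_scaleR)
next
  case (Suc k)
  have "Ck_on k S (\<lambda>x. a x *\<^sub>R frechet_derivative f (at x) v + frechet_derivative a (at x) v *\<^sub>R f x)" for v
    by (intro Ck_on_add[OF assms(1)] Suc.IH Ck_on_Suc_imp[OF Suc.prems(1)] Ck_on_Suc_imp[OF Suc.prems(2)])
       (use Suc.prems in auto)
  then show ?case
    by (intro Ck_on_SucI[OF assms(1), where f' = "\<lambda>x v. a x *\<^sub>R frechet_derivative f (at x) v + frechet_derivative a (at x) v *\<^sub>R f x"])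
       (auto intro!: has_derivative_scaleR
          Ck_on_Suc_has_derivative[OF Suc.prems(1)] Ck_on_Suc_has_derivative[OF Suc.prems(2)])
qed

lemma linear_euclidean_expand:
  fixes L :: "'e::euclidean_space \<Rightarrow> 'f::real_vector"
  assumes "linear L"
  shows "L v = (\<Sum>i\<in>Basis. (v \<bullet> i) *\<^sub>R L i)"
proof -
  have "L v = L (\<Sum>i\<in>Basis. (v \<bullet> i) *\<^sub>R i)" by (simp add: euclidean_representation)
  also have "\<dots> = (\<Sum>i\<in>Basis. (v \<bullet> i) *\<^sub>R L i)"
    using assms by (simp add: linear_sum linear_scale)
  finally show ?thesis .
qed

text \<open>The directional derivative of \<open>f \<circ> h\<close> is $\sum_i (\partial_v h)_i \, (\partial_i f) \circ h$, a finite sum of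
  products whose factors are of class \<open>k\<close> by the induction hypothesis. Expanding along a basis needs a
  Euclidean space in the middle.\<close>

lemma Ck_on_compose:
  fixes f :: "'e::euclidean_space \<Rightarrow> 'f::real_normed_vector"
  assumes "open S" "open T" "Ck_on k T f" "Ck_on k S h" "h ` S \<subseteq> T"
  shows "Ck_on k S (\<lambda>x. f (h x))"
  using assms(3,4)
proof (induction k arbitrary: f)
  case 0
  then show ?case using assms(5) by (auto intro: continuous_on_compose2)
next
  case (Suc k)
  let ?D = "\<lambda>x v. frechet_derivative f (at (h x)) (frechet_derivative h (at x) v)"
  have d: "((\<lambda>x. f (h x)) has_derivative ?D x) (at x)" if "x \<in> S" for x
  proof -
    have "h x \<in> T" using that assms(5) by auto
    then show ?thesis
      using has_derivative_compose[OF Ck_on_Suc_has_derivative[OF Suc.prems(2) that]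
          Ck_on_Suc_has_derivative[OF Suc.prems(1)]] by simp
  qed
  have eq: "(\<Sum>i\<in>Basis. (frechet_derivative h (at x) v \<bullet> i) *\<^sub>R frechet_derivative f (at (h x)) i) = ?D x v"
    if "x \<in> S" for x v
  proof -
    have "h x \<in> T" using that assms(5) by auto
    then have "linear (frechet_derivative f (at (h x)))"
      using Ck_on_Suc_has_derivative[OF Suc.prems(1)] has_derivative_linear by blast
    from linear_euclidean_expand[OF this] show ?thesis by metis
  qed
  have "Ck_on k S (\<lambda>x. ?D x v)" for v
  proof (rule Ck_on_cong[OF assms(1) _ eq])
    have h: "Ck_on k S (\<lambda>x. frechet_derivative h (at x) v)" using Suc.prems(2) by simp
    show "Ck_on k S (\<lambda>x. \<Sum>i\<in>Basis. (frechet_derivative h (at x) v \<bullet> i) *\<^sub>R frechet_derivative f (at (h x)) i)"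
      by (intro Ck_on_sum[OF assms(1)] Ck_on_scaleR[OF assms(1)]
          Ck_on_bounded_linear[OF assms(1) bounded_linear_inner_left h] Suc.IH
          Ck_on_Suc_imp[OF Suc.prems(2)]) (use Suc.prems(1) in auto)
  qed auto
  with d show ?case by (intro Ck_on_SucI[OF assms(1), of _ ?D])
qed

lemma smooth_on_subset: "smooth_on S f \<Longrightarrow> T \<subseteq> S \<Longrightarrow> smooth_on T f"
  unfolding smooth_on_def using Ck_on_subset by blast

lemma smooth_on_cong:
  "open S \<Longrightarrow> smooth_on S f \<Longrightarrow> (\<And>x. x \<in> S \<Longrightarrow> f x = h x) \<Longrightarrow> smooth_on S h"
  unfolding smooth_on_def using Ck_on_cong by blast

lemma smooth_on_const: "open S \<Longrightarrow> smooth_on S (\<lambda>x. c)"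
  by (simp add: smooth_on_def Ck_on_const)

lemma smooth_on_id: "open S \<Longrightarrow> smooth_on S (\<lambda>x. x)"
  by (simp add: smooth_on_def Ck_on_id)

lemma smooth_on_bounded_linear:
  "open S \<Longrightarrow> bounded_linear L \<Longrightarrow> smooth_on S f \<Longrightarrow> smooth_on S (\<lambda>x. L (f x))"
  by (simp add: smooth_on_def Ck_on_bounded_linear)

lemma smooth_on_add:
  "open S \<Longrightarrow> smooth_on S f \<Longrightarrow> smooth_on S h \<Longrightarrow> smooth_on S (\<lambda>x. f x + h x)"
  by (simp add: smooth_on_def Ck_on_add)

lemma smooth_on_sum:
  "open S \<Longrightarrow> (\<And>i. i \<in> I \<Longrightarrow> smooth_on S (f i)) \<Longrightarrow> smooth_on S (\<lambda>x. \<Sum>i\<in>I. f i x)"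
  by (simp add: smooth_on_def Ck_on_sum)

lemma smooth_on_scaleR:
  "open S \<Longrightarrow> smooth_on S a \<Longrightarrow> smooth_on S f \<Longrightarrow> smooth_on S (\<lambda>x. a x *\<^sub>R f x)"
  by (simp add: smooth_on_def Ck_on_scaleR)

lemma smooth_on_mult:
  fixes a f :: "'e::real_normed_vector \<Rightarrow> real"
  shows "open S \<Longrightarrow> smooth_on S a \<Longrightarrow> smooth_on S f \<Longrightarrow> smooth_on S (\<lambda>x. a x * f x)"
  using smooth_on_scaleR[of S a f] by simp

lemma smooth_on_Pair:
  assumes "open S" "smooth_on S f" "smooth_on S h"
  shows "smooth_on S (\<lambda>x. (f x, h x))"
proof -
  have "smooth_on S (\<lambda>x. (f x, 0) + (0, h x))"
    by (intro smooth_on_add assms smooth_on_bounded_linear[OF _ _ assms(2)]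
        smooth_on_bounded_linear[OF _ _ assms(3)] bounded_linear_Pair bounded_linear_zero bounded_linear_ident)
  then show ?thesis by simp
qed

lemma smooth_on_compose:
  fixes f :: "'e::euclidean_space \<Rightarrow> 'f::real_normed_vector"
  shows "open S \<Longrightarrow> open T \<Longrightarrow> smooth_on T f \<Longrightarrow> smooth_on S h \<Longrightarrow> h ` S \<subseteq> T \<Longrightarrow>
    smooth_on S (\<lambda>x. f (h x))"
  unfolding smooth_on_def using Ck_on_compose by blast

lemma smooth_on_frechet_derivative:
  "smooth_on S f \<Longrightarrow> smooth_on S (\<lambda>x. frechet_derivative f (at x) v)"
  unfolding smooth_on_def by (metis Ck_on.simps(2))

lemma smooth_on_has_derivative:
  "smooth_on S f \<Longrightarrow> x \<in> S \<Longrightarrow> (f has_derivative frechet_derivative f (at x)) (at x)"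
  unfolding smooth_on_def using Ck_on_Suc_has_derivative by blast

lemma smooth_on_continuous_on: "smooth_on S f \<Longrightarrow> continuous_on S f"
  unfolding smooth_on_def by (metis Ck_on.simps(1))

lemma smooth_on_frechet_linear:
  "smooth_on S f \<Longrightarrow> x \<in> S \<Longrightarrow> linear (frechet_derivative f (at x))"
  using smooth_on_has_derivative has_derivative_linear by blast

lemma frechet_derivative_eq_on_open:
  assumes "open S" "x \<in> S" "\<And>y. y \<in> S \<Longrightarrow> f y = h y"
  shows "frechet_derivative f (at x) = frechet_derivative h (at x)"
proof -
  have "(f has_derivative D) (at x) \<longleftrightarrow> (h has_derivative D) (at x)" for D
    using has_derivative_transform_within_open[OF _ assms(1,2)] assms(3) by metis
  then show ?thesis unfolding frechet_derivative_def by simp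
qed

section \<open>Symmetry of second derivatives\<close>

text \<open>Two applications of the mean value theorem, first along \<open>u\<close> and then along \<open>v\<close>, turn the mixed second
  difference into a value of the mixed second derivative. The second difference is symmetric in \<open>u\<close> and \<open>v\<close>,
  and the symmetry of second derivatives comes from there.\<close>

lemma mixed_difference_mean_value:
  fixes f :: "'e::real_normed_vector \<Rightarrow> real"
  assumes S: "ball x r \<subseteq> S" and f: "smooth_on S f" and h: "h > 0" and r: "h * (norm u + norm v) < r"
  shows "\<exists>a b. 0 < a \<and> a < h \<and> 0 < b \<and> b < h \<and>
    f (x + h *\<^sub>R u + h *\<^sub>R v) - f (x + h *\<^sub>R u) - f (x + h *\<^sub>R v) + f x
    = h * h * frechet_derivative (\<lambda>y. frechet_derivative f (at y) u) (at (x + a *\<^sub>R u + b *\<^sub>R v)) v"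
proof -
  have mem: "x + s *\<^sub>R u + t *\<^sub>R v \<in> S" if "0 \<le> s" "s \<le> h" "0 \<le> t" "t \<le> h" for s t
  proof -
    have "norm (s *\<^sub>R u + t *\<^sub>R v) \<le> s * norm u + t * norm v"
      using that norm_triangle_ineq[of "s *\<^sub>R u" "t *\<^sub>R v"] by simp
    also have "\<dots> \<le> h * norm u + h * norm v"
      using that by (intro add_mono mult_right_mono) auto
    finally have "norm (s *\<^sub>R u + t *\<^sub>R v) < r" using r by (simp add: algebra_simps)
    then have "dist (x + s *\<^sub>R u + t *\<^sub>R v) x < r"
      by (simp add: dist_norm add.assoc)
    then have "x + s *\<^sub>R u + t *\<^sub>R v \<in> ball x r"
      by (simp add: dist_commute)
    then show ?thesis using S by auto
  qed
  let ?fu = "\<lambda>y. frechet_derivative f (at y) u"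
  define G where "G s = f (x + s *\<^sub>R u + h *\<^sub>R v) - f (x + s *\<^sub>R u + 0 *\<^sub>R v)" for s
  have dG: "(G has_real_derivative (?fu (x + s *\<^sub>R u + h *\<^sub>R v) - ?fu (x + s *\<^sub>R u + 0 *\<^sub>R v))) (at s)"
    if "0 \<le> s" "s \<le> h" for s
  proof -
    have "((\<lambda>s. f (x + s *\<^sub>R u + t *\<^sub>R v)) has_real_derivative ?fu (x + s *\<^sub>R u + t *\<^sub>R v)) (at s)"
      if "0 \<le> t" "t \<le> h" for t
    proof -
      have D: "(f has_derivative frechet_derivative f (at (x + s *\<^sub>R u + t *\<^sub>R v))) (at (x + s *\<^sub>R u + t *\<^sub>R v))"
        by (rule smooth_on_has_derivative[OF f mem]) fact+
      have "((\<lambda>s. x + s *\<^sub>R u + t *\<^sub>R v) has_derivative (\<lambda>z. z *\<^sub>R u)) (at s)"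
        by (auto intro!: derivative_eq_intros)
      from has_derivative_compose[OF this D] show ?thesis
        unfolding has_field_derivative_def
        using linear_scale[OF has_derivative_linear[OF D]] by (simp add: mult_commute_abs)
    qed
    from DERIV_diff[OF this[of h] this[of 0]] show ?thesis
      unfolding G_def using h by simp
  qed
  obtain a where a: "0 < a" "a < h" and
    Ga: "G h - G 0 = (h - 0) * (?fu (x + a *\<^sub>R u + h *\<^sub>R v) - ?fu (x + a *\<^sub>R u + 0 *\<^sub>R v))"
    using MVT2[OF h dG] by auto
  define K where "K t = ?fu (x + a *\<^sub>R u + t *\<^sub>R v)" for t
  have dK: "(K has_real_derivative (frechet_derivative ?fu (at (x + a *\<^sub>R u + t *\<^sub>R v)) v)) (at t)"
    if "0 \<le> t" "t \<le> h" for t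
  proof -
    have D: "(?fu has_derivative frechet_derivative ?fu (at (x + a *\<^sub>R u + t *\<^sub>R v))) (at (x + a *\<^sub>R u + t *\<^sub>R v))"
      by (rule smooth_on_has_derivative[OF smooth_on_frechet_derivative[OF f] mem]) (use a that in auto)
    have "((\<lambda>t. x + a *\<^sub>R u + t *\<^sub>R v) has_derivative (\<lambda>z. z *\<^sub>R v)) (at t)"
      by (auto intro!: derivative_eq_intros)
    from has_derivative_compose[OF this D] show ?thesis
      unfolding K_def has_field_derivative_def
      using linear_scale[OF has_derivative_linear[OF D]] by (simp add: mult_commute_abs)
  qed
  obtain b where b: "0 < b" "b < h" and
    Kb: "K h - K 0 = (h - 0) * (frechet_derivative ?fu (at (x + a *\<^sub>R u + b *\<^sub>R v)) v)"
    using MVT2[OF h dK] by auto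
  have "f (x + h *\<^sub>R u + h *\<^sub>R v) - f (x + h *\<^sub>R u) - f (x + h *\<^sub>R v) + f x = G h - G 0"
    by (simp add: G_def)
  also have "\<dots> = h * (K h - K 0)" using Ga by (simp add: K_def)
  also have "\<dots> = h * h * frechet_derivative ?fu (at (x + a *\<^sub>R u + b *\<^sub>R v)) v" using Kb by simp
  finally show ?thesis using a b by blast
qed

lemma second_derivative_symmetric_real:
  fixes f :: "'e::real_normed_vector \<Rightarrow> real"
  assumes "open S" "x \<in> S" "smooth_on S f"
  shows "frechet_derivative (\<lambda>y. frechet_derivative f (at y) u) (at x) v
    = frechet_derivative (\<lambda>y. frechet_derivative f (at y) v) (at x) u"
proof (rule ccontr)
  let ?P = "\<lambda>u v y. frechet_derivative (\<lambda>y. frechet_derivative f (at y) u) (at y) v"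
  assume ne: "\<not> ?thesis"
  \<comment> \<open>Both mixed derivatives stay within \<open>e\<close> of their values at \<open>x\<close> near \<open>x\<close>, but take a common value there,
    whereas these values differ by \<open>2 * e\<close>.\<close>
  define e where "e = \<bar>?P u v x - ?P v u x\<bar> / 2"
  have e: "e > 0" using ne by (simp add: e_def)
  have cont: "continuous (at x) (?P u v)" for u v
    using smooth_on_continuous_on[OF smooth_on_frechet_derivative[OF smooth_on_frechet_derivative[OF assms(3)]]]
      assms(1,2) by (simp add: continuous_on_eq_continuous_at)
  obtain r where r: "r > 0" "ball x r \<subseteq> S"
    using assms(1,2) by (meson openE)
  obtain d1 where d1: "d1 > 0" "\<And>y. dist y x < d1 \<Longrightarrow> \<bar>?P u v y - ?P u v x\<bar> < e"
    using cont[of u v] e unfolding continuous_at_eps_delta dist_real_def by (metis norm_conv_dist dist_norm real_norm_def)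
  obtain d2 where d2: "d2 > 0" "\<And>y. dist y x < d2 \<Longrightarrow> \<bar>?P v u y - ?P v u x\<bar> < e"
    using cont[of v u] e unfolding continuous_at_eps_delta dist_real_def by (metis norm_conv_dist dist_norm real_norm_def)
  define m where "m = min r (min d1 d2)"
  have m: "m > 0" using r d1 d2 by (simp add: m_def)
  define n where "n = norm u + norm v + 1"
  have n: "n > 0" "norm u + norm v < n" using norm_ge_zero[of u] norm_ge_zero[of v] unfolding n_def by linarith+
  define h where "h = m / n"
  have h: "h > 0" "h * (norm u + norm v) < m"
    using m n by (auto simp: h_def divide_simps mult_less_cancel_left)
  have hr: "h * (norm u + norm v) < r" "h * (norm v + norm u) < r"
    using h(2) by (auto simp: m_def algebra_simps)
  have near: "dist (x + a *\<^sub>R u' + b *\<^sub>R v') x < m" if "0 < a" "a < h" "0 < b" "b < h"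
    "norm u' + norm v' = norm u + norm v" for a b u' v'
  proof -
    have "norm (a *\<^sub>R u' + b *\<^sub>R v') \<le> a * norm u' + b * norm v'"
      using that norm_triangle_ineq[of "a *\<^sub>R u'" "b *\<^sub>R v'"] by simp
    also have "\<dots> \<le> h * norm u' + h * norm v'"
      using that by (intro add_mono mult_right_mono) auto
    also have "\<dots> < m" using h(2) that(5) by (simp flip: distrib_left)
    finally show ?thesis by (simp add: dist_norm add.assoc)
  qed
  obtain a b where ab: "0 < a" "a < h" "0 < b" "b < h"
    "f (x + h *\<^sub>R u + h *\<^sub>R v) - f (x + h *\<^sub>R u) - f (x + h *\<^sub>R v) + f x = h * h * ?P u v (x + a *\<^sub>R u + b *\<^sub>R v)"
    using mixed_difference_mean_value[OF r(2) assms(3) h(1) hr(1)] by metis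
  obtain a' b' where ab': "0 < a'" "a' < h" "0 < b'" "b' < h"
    "f (x + h *\<^sub>R v + h *\<^sub>R u) - f (x + h *\<^sub>R v) - f (x + h *\<^sub>R u) + f x = h * h * ?P v u (x + a' *\<^sub>R v + b' *\<^sub>R u)"
    using mixed_difference_mean_value[OF r(2) assms(3) h(1) hr(2)] by metis
  have "h * h * ?P u v (x + a *\<^sub>R u + b *\<^sub>R v) = h * h * ?P v u (x + a' *\<^sub>R v + b' *\<^sub>R u)"
    using ab(5) ab'(5) by (simp add: algebra_simps)
  then have "?P u v (x + a *\<^sub>R u + b *\<^sub>R v) = ?P v u (x + a' *\<^sub>R v + b' *\<^sub>R u)"
    using h(1) by simp
  moreover have "\<bar>?P u v (x + a *\<^sub>R u + b *\<^sub>R v) - ?P u v x\<bar> < e"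
    using near[OF ab(1-4)] by (intro d1(2)) (simp add: m_def)
  moreover have "\<bar>?P v u (x + a' *\<^sub>R v + b' *\<^sub>R u) - ?P v u x\<bar> < e"
    using near[OF ab'(1-4)] by (intro d2(2)) (simp add: m_def)
  ultimately show False unfolding e_def by (auto simp: abs_if split: if_splits)
qed

lemma second_derivative_symmetric:
  fixes f :: "'e::real_normed_vector \<Rightarrow> 'f::euclidean_space"
  assumes "open S" "x \<in> S" "smooth_on S f"
  shows "frechet_derivative (\<lambda>y. frechet_derivative f (at y) u) (at x) v
    = frechet_derivative (\<lambda>y. frechet_derivative f (at y) v) (at x) u"
proof (rule euclidean_eqI)
  fix i :: 'f assume "i \<in> Basis"
  have d: "frechet_derivative (\<lambda>y. k y \<bullet> i) (at z) w = frechet_derivative k (at z) w \<bullet> i"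
    if "z \<in> S" "smooth_on S k" for k :: "'e \<Rightarrow> 'f" and z w
    using frechet_derivative_at[OF bounded_linear.has_derivative[OF bounded_linear_inner_left
          smooth_on_has_derivative[OF that(2,1)]], of i] by metis
  have "frechet_derivative (\<lambda>y. frechet_derivative f (at y) u) (at x) v \<bullet> i
    = frechet_derivative (\<lambda>y. frechet_derivative (\<lambda>y. f y \<bullet> i) (at y) u) (at x) v" for u v
  proof -
    have "frechet_derivative (\<lambda>y. frechet_derivative f (at y) u) (at x) v \<bullet> i
      = frechet_derivative (\<lambda>y. frechet_derivative f (at y) u \<bullet> i) (at x) v"
      using d[OF assms(2) smooth_on_frechet_derivative[OF assms(3)]] by simp
    also have "\<dots> = frechet_derivative (\<lambda>y. frechet_derivative (\<lambda>y. f y \<bullet> i) (at y) u) (at x) v"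
      by (rule fun_cong[OF frechet_derivative_eq_on_open[OF assms(1,2)]]) (use d assms in auto)
    finally show ?thesis .
  qed
  then show "frechet_derivative (\<lambda>y. frechet_derivative f (at y) u) (at x) v \<bullet> i
    = frechet_derivative (\<lambda>y. frechet_derivative f (at y) v) (at x) u \<bullet> i"
    using second_derivative_symmetric_real[OF assms(1,2)
        smooth_on_bounded_linear[OF assms(1) bounded_linear_inner_left assms(3)]] by simp
qed

section \<open>Bump functions\<close>

text \<open>The functions $p(1/r)\,e^{-1/r}$, extended by zero to $r \le 0$. The polynomial factor makes the family
  closed under differentiation, so that one induction gives smoothness for all of them.\<close>

definition flat_exp :: "real poly \<Rightarrow> real \<Rightarrow> real" where
  "flat_exp p r = (if r > 0 then poly p (1 / r) * exp (- (1 / r)) else 0)"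

lemma poly_times_exp_minus_tendsto_0: "((\<lambda>s::real. poly p s * exp (- s)) \<longlongrightarrow> 0) at_top"
proof -
  have "((\<lambda>s::real. \<Sum>i\<le>degree p. coeff p i * (s ^ i / exp s)) \<longlongrightarrow> (\<Sum>i\<le>degree p. coeff p i * 0)) at_top"
    by (intro tendsto_sum tendsto_mult tendsto_const tendsto_power_div_exp_0)
  then show ?thesis
    by (simp add: poly_altdef exp_minus divide_inverse sum_distrib_right mult.assoc)
qed

text \<open>With $s = 1/r$ one has $s' = -s^2$, hence $(p(s)e^{-s})' = s^2(p(s) - p'(s))e^{-s}$. At \<open>r = 0\<close> the
  difference quotient from the right is $s\,p(s)e^{-s}$ with $s \to \infty$.\<close>

lemma flat_exp_has_derivative:
  "(flat_exp p has_real_derivative flat_exp (monom 1 2 * (p - pderiv p)) r) (at r)"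
proof -
  consider "r > 0" | "r < 0" | "r = 0" by linarith
  then show ?thesis
  proof cases
    case 1
    have "((\<lambda>r. poly p (1 / r) * exp (- (1 / r))) has_real_derivative
        flat_exp (monom 1 2 * (p - pderiv p)) r) (at r)"
      using 1 by (auto intro!: derivative_eq_intros
          simp: flat_exp_def poly_monom field_simps power2_eq_square)
    then show ?thesis
      by (rule DERIV_cong_ev[THEN iffD1, rotated -1, OF _ refl _ refl])
        (use 1 eventually_nhds_in_open[of "{0<..}" r] in \<open>auto simp: flat_exp_def elim!: eventually_mono\<close>)
  next
    case 2
    have "((\<lambda>r. 0) has_real_derivative flat_exp (monom 1 2 * (p - pderiv p)) r) (at r)"
      using 2 by (auto simp: flat_exp_def)
    then show ?thesis
      by (rule DERIV_cong_ev[THEN iffD1, rotated -1, OF _ refl _ refl])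
        (use 2 eventually_nhds_in_open[of "{..<0}" r] in \<open>auto simp: flat_exp_def elim!: eventually_mono\<close>)
  next
    case 3
    have "((\<lambda>y. flat_exp p y / y) \<longlongrightarrow> 0) (at_left 0)"
    proof (rule tendsto_eventually)
      show "\<forall>\<^sub>F y in at_left 0. flat_exp p y / y = 0"
        using eventually_at_left_real[of "-1" 0]
        by (auto simp: flat_exp_def elim!: eventually_mono)
    qed
    moreover have "((\<lambda>y. flat_exp p y / y) \<longlongrightarrow> 0) (at_right 0)"
      unfolding filterlim_at_right_to_top
    proof (rule Lim_transform_eventually)
      show "((\<lambda>s::real. poly (pCons 0 p) s * exp (- s)) \<longlongrightarrow> 0) at_top"
        by (rule poly_times_exp_minus_tendsto_0)
      show "\<forall>\<^sub>F s in at_top. poly (pCons 0 p) s * exp (- s) = flat_exp p (inverse s) / inverse s"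
        using eventually_gt_at_top[of 0]
        by eventually_elim (simp add: flat_exp_def field_simps)
    qed
    ultimately have "((\<lambda>y. flat_exp p y / y) \<longlongrightarrow> 0) (at 0)"
      by (simp add: filterlim_split_at)
    then show ?thesis
      unfolding 3 has_field_derivative_iff by (simp add: flat_exp_def)
  qed
qed

lemma smooth_on_flat_exp: "smooth_on UNIV (flat_exp p)"
proof -
  have "Ck_on k UNIV (flat_exp p)" for k
  proof (induction k arbitrary: p)
    case 0
    then show ?case
      using DERIV_isCont[OF flat_exp_has_derivative] by (simp add: continuous_at_imp_continuous_on)
  next
    case (Suc k)
    show ?case
    proof (rule Ck_on_SucI)
      show "(flat_exp p has_derivative (\<lambda>v. v *\<^sub>R flat_exp (monom 1 2 * (p - pderiv p)) r)) (at r)" for r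
        using flat_exp_has_derivative[of p r] by (simp add: has_field_derivative_def mult_commute_abs)
      show "Ck_on k UNIV (\<lambda>r. v *\<^sub>R flat_exp (monom 1 2 * (p - pderiv p)) r)" for v
        by (rule Ck_on_scaleR) (auto intro: Ck_on_const Suc.IH)
    qed auto
  qed
  then show ?thesis by (simp add: smooth_on_def)
qed

text \<open>The function $\psi(e^2 - |x - x_0|^2)$ with $\psi(r) = e^{-1/r}$ has a maximum at \<open>x0\<close>. A critical point there
  is all that later arguments ask for: it makes the brackets of the fields \<open>\<beta> \<partial>\<^sub>v\<close> vanish at \<open>x0\<close>, just as a
  function that is constant near \<open>x0\<close> would.\<close>

lemma bump_function_exists:
  fixes x0 :: "'e::euclidean_space"
  assumes "open S" "x0 \<in> S"
  obtains \<beta> :: "'e \<Rightarrow> real" and K where "smooth_on UNIV \<beta>" "\<beta> x0 \<noteq> 0"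
    "frechet_derivative \<beta> (at x0) = (\<lambda>_. 0)" "compact K" "K \<subseteq> S" "\<forall>x. x \<notin> K \<longrightarrow> \<beta> x = 0"
proof -
  obtain e where e: "e > 0" "cball x0 e \<subseteq> S"
    using assms open_contains_cball by blast
  define N where "N x = e\<^sup>2 - (x - x0) \<bullet> (x - x0)" for x
  define \<beta> where "\<beta> x = flat_exp 1 (N x)" for x
  have smN: "smooth_on UNIV N"
  proof -
    have "smooth_on UNIV (\<lambda>x. e\<^sup>2 + (\<Sum>i\<in>Basis. - (((x - x0) \<bullet> i) * ((x - x0) \<bullet> i))))"
    proof (intro smooth_on_add smooth_on_sum smooth_on_const open_UNIV)
      fix i :: 'e
      have "smooth_on UNIV (\<lambda>x. (x + (- x0)) \<bullet> i)"
        by (intro smooth_on_bounded_linear[OF open_UNIV bounded_linear_inner_left]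
            smooth_on_add smooth_on_id smooth_on_const open_UNIV)
      then have l: "smooth_on UNIV (\<lambda>x. (x - x0) \<bullet> i)" by simp
      have "smooth_on UNIV (\<lambda>x. (-1) * (((x - x0) \<bullet> i) * ((x - x0) \<bullet> i)))"
        by (intro smooth_on_mult l smooth_on_const open_UNIV)
      then show "smooth_on UNIV (\<lambda>x. - (((x - x0) \<bullet> i) * ((x - x0) \<bullet> i)))" by simp
    qed
    then show ?thesis
      unfolding N_def by (subst euclidean_inner) (simp add: sum_negf)
  qed
  have 1: "smooth_on UNIV \<beta>"
    unfolding \<beta>_def by (rule smooth_on_compose[OF _ _ smooth_on_flat_exp smN]) auto
  have 2: "\<beta> x0 \<noteq> 0" using e by (simp add: \<beta>_def N_def flat_exp_def)
  have "(N has_derivative (\<lambda>_. 0)) (at x0)"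
    unfolding N_def by (auto intro!: derivative_eq_intros)
  then have "(\<beta> has_derivative (\<lambda>_. 0)) (at x0)"
    unfolding \<beta>_def
    using has_derivative_compose[OF _ smooth_on_has_derivative[OF smooth_on_flat_exp UNIV_I]]
      linear_0[OF smooth_on_frechet_linear[OF smooth_on_flat_exp UNIV_I]] by fastforce
  then have 3: "frechet_derivative \<beta> (at x0) = (\<lambda>_. 0)"
    using frechet_derivative_at by metis
  have 4: "\<forall>x. x \<notin> cball x0 e \<longrightarrow> \<beta> x = 0"
  proof (intro allI impI)
    fix x assume that: "x \<notin> cball x0 e"
    have "e < norm (x - x0)" using that by (simp add: dist_norm norm_minus_commute)
    then have "e\<^sup>2 \<le> (norm (x - x0))\<^sup>2" using e by (intro power_mono) auto
    then show "\<beta> x = 0" by (simp add: \<beta>_def N_def flat_exp_def dot_square_norm)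
  qed
  from that[OF 1 2 3 compact_cball e(2) 4] show ?thesis .
qed

section \<open>Charts and smooth maps\<close>

lemma chart_inv_left: "is_chart c \<Longrightarrow> p \<in> fst c \<Longrightarrow> chart_inv c (snd c p) = p"
  unfolding is_chart_def chart_inv_def homeomorphism_def
  by (metis inj_on_inverseI inv_into_f_f)

lemma chart_inv_right: "y \<in> snd c ` fst c \<Longrightarrow> snd c (chart_inv c y) = y"
  unfolding chart_inv_def by (rule f_inv_into_f)

lemma chart_inv_in: "y \<in> snd c ` fst c \<Longrightarrow> chart_inv c y \<in> fst c"
  unfolding chart_inv_def by (rule inv_into_into)

lemma chart_inv_in_subset:
  "is_chart c \<Longrightarrow> W \<subseteq> fst c \<Longrightarrow> y \<in> snd c ` W \<Longrightarrow> chart_inv c y \<in> W"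
  using chart_inv_left by fastforce

lemma continuous_on_chart: "is_chart c \<Longrightarrow> continuous_on (fst c) (snd c)"
  unfolding is_chart_def homeomorphism_def by blast

lemma continuous_on_chart_inv:
  assumes "is_chart c"
  shows "continuous_on (snd c ` fst c) (chart_inv c)"
proof -
  obtain k where k: "homeomorphism (fst c) (snd c ` fst c) (snd c) k"
    using assms is_chart_def by blast
  have "k y = chart_inv c y" if "y \<in> snd c ` fst c" for y
    using that k chart_inv_left[OF assms] by (auto simp: homeomorphism_def)
  moreover have "continuous_on (snd c ` fst c) k" using k by (simp add: homeomorphism_def)
  ultimately show ?thesis by (rule continuous_on_eq[rotated])
qed

lemma open_chart_image:
  assumes "is_chart c" "open W" "W \<subseteq> fst c"
  shows "open (snd c ` W)"
proof -
  have "snd c ` W = snd c ` fst c \<inter> chart_inv c -` W"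
    using assms(3) chart_inv_left[OF assms(1)] by force
  then show ?thesis
    using continuous_open_preimage[OF continuous_on_chart_inv[OF assms(1)] _ assms(2)] assms(1)
    unfolding is_chart_def by metis
qed

lemma smooth_manifold_is_chart: "smooth_manifold A \<Longrightarrow> c \<in> A \<Longrightarrow> is_chart c"
  by (auto simp: smooth_manifold_def)

lemma smooth_manifold_chart_at:
  assumes "smooth_manifold A"
  obtains c where "c \<in> A" "p \<in> fst c"
  using assms unfolding smooth_manifold_def by blast

lemma smooth_manifold_transition:
  "smooth_manifold A \<Longrightarrow> c \<in> A \<Longrightarrow> d \<in> A \<Longrightarrow>
    smooth_on (snd c ` (fst c \<inter> fst d)) (\<lambda>x. snd d (chart_inv c x))"
  by (auto simp: smooth_manifold_def o_def)

lemma is_chart_open: "is_chart c \<Longrightarrow> open (fst c)"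
  by (simp add: is_chart_def)

lemma smooth_nearI:
  assumes "c \<in> A" "d \<in> B" "open W" "p \<in> W" "W \<subseteq> fst c" "F ` W \<subseteq> fst d"
    "smooth_on (snd c ` W) (\<lambda>x. snd d (F (chart_inv c x)))"
  shows "smooth_near A B F p"
  unfolding smooth_near_def using assms by (auto simp: o_def)

lemma smooth_near_continuous:
  assumes A: "smooth_manifold A" and B: "smooth_manifold B" and F: "smooth_near A B F p"
  obtains W where "open W" "p \<in> W" "continuous_on W F"
proof -
  obtain c d W where *: "c \<in> A" "d \<in> B" "open W" "p \<in> W" "W \<subseteq> fst c" "F ` W \<subseteq> fst d"
    "smooth_on (snd c ` W) (snd d \<circ> F \<circ> chart_inv c)"
    using F unfolding smooth_near_def by blast
  have c: "is_chart c" and d: "is_chart d" using A B * smooth_manifold_is_chart by blast+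
  have "continuous_on W (\<lambda>q. chart_inv d ((snd d \<circ> F \<circ> chart_inv c) (snd c q)))"
  proof (rule continuous_on_compose2[OF continuous_on_chart_inv[OF d]])
    show "continuous_on W (\<lambda>q. (snd d \<circ> F \<circ> chart_inv c) (snd c q))"
      by (rule continuous_on_compose2[OF smooth_on_continuous_on[OF *(7)]])
        (use continuous_on_chart[OF c] *(5) in \<open>auto intro: continuous_on_subset\<close>)
    show "(\<lambda>q. (snd d \<circ> F \<circ> chart_inv c) (snd c q)) ` W \<subseteq> snd d ` fst d"
      using *(5,6) chart_inv_left[OF c] by (fastforce simp: subset_eq)
  qed
  moreover have "chart_inv d ((snd d \<circ> F \<circ> chart_inv c) (snd c q)) = F q" if "q \<in> W" for q
    using that *(5,6) chart_inv_left[OF c] chart_inv_left[OF d] by (auto simp: subset_eq)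
  ultimately have "continuous_on W F" using continuous_on_eq by blast
  with *(3,4) that show ?thesis by blast
qed

text \<open>Smoothness near \<open>p\<close> asks for some pair of charts. Composing with the transition maps on both sides
  gives it in any prescribed pair.\<close>

lemma smooth_near_in_charts:
  assumes A: "smooth_manifold A" and B: "smooth_manifold B" and F: "smooth_near A B F p"
    and c: "c \<in> A" "p \<in> fst c" and d: "d \<in> B" "F p \<in> fst d"
  obtains W where "open W" "p \<in> W" "W \<subseteq> fst c" "F ` W \<subseteq> fst d"
    "smooth_on (snd c ` W) (\<lambda>x. snd d (F (chart_inv c x)))"
proof -
  obtain c' d' W' where *: "c' \<in> A" "d' \<in> B" "open W'" "p \<in> W'" "W' \<subseteq> fst c'" "F ` W' \<subseteq> fst d'"
    "smooth_on (snd c' ` W') (snd d' \<circ> F \<circ> chart_inv c')"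
    using F unfolding smooth_near_def by blast
  obtain V where V: "open V" "p \<in> V" "continuous_on V F"
    using smooth_near_continuous[OF A B F] .
  note ch = smooth_manifold_is_chart[OF A c(1)] smooth_manifold_is_chart[OF A *(1)]
    smooth_manifold_is_chart[OF B d(1)] smooth_manifold_is_chart[OF B *(2)]
  define W where "W = W' \<inter> fst c \<inter> (V \<inter> F -` fst d)"
  have "open W"
    unfolding W_def using * ch V
    by (intro open_Int continuous_open_preimage is_chart_open) auto
  then have W: "open W" "p \<in> W" "W \<subseteq> fst c" "F ` W \<subseteq> fst d" "W \<subseteq> W'"
    using * c d V by (auto simp: W_def)
  have oW: "open (snd c ` W)" by (rule open_chart_image[OF ch(1) W(1,3)])
  have inW: "chart_inv c x \<in> W" if "x \<in> snd c ` W" for x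
    using chart_inv_in_subset[OF ch(1) W(3) that] .
  have 1: "smooth_on (snd c ` W) (\<lambda>x. snd c' (chart_inv c x))"
    by (rule smooth_on_subset[OF smooth_manifold_transition[OF A c(1) *(1)]]) (use W *(5) in blast)
  have 2: "smooth_on (snd c ` W) (\<lambda>x. (snd d' \<circ> F \<circ> chart_inv c') (snd c' (chart_inv c x)))"
    by (rule smooth_on_compose[OF oW open_chart_image[OF ch(2) *(3,5)] *(7) 1])
      (use inW W(5) in auto)
  have 3: "smooth_on (snd c ` W) (\<lambda>x. snd d (chart_inv d' ((snd d' \<circ> F \<circ> chart_inv c') (snd c' (chart_inv c x)))))"
  proof (rule smooth_on_compose[OF oW _ smooth_manifold_transition[OF B *(2) d(1)] 2])
    show "open (snd d' ` (fst d' \<inter> fst d))"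
      by (intro open_chart_image open_Int is_chart_open ch) auto
    show "(\<lambda>x. (snd d' \<circ> F \<circ> chart_inv c') (snd c' (chart_inv c x))) ` snd c ` W \<subseteq> snd d' ` (fst d' \<inter> fst d)"
    proof clarify
      fix q assume "q \<in> W"
      then have "chart_inv c (snd c q) = q" "chart_inv c' (snd c' q) = q" "F q \<in> fst d' \<inter> fst d"
        using W *(5,6) chart_inv_left[OF ch(1)] chart_inv_left[OF ch(2)] by (auto simp: subset_eq)
      then show "(snd d' \<circ> F \<circ> chart_inv c') (snd c' (chart_inv c (snd c q))) \<in> snd d' ` (fst d' \<inter> fst d)"
        by auto
    qed
  qed
  have "smooth_on (snd c ` W) (\<lambda>x. snd d (F (chart_inv c x)))"
  proof (rule smooth_on_cong[OF oW 3])
    fix x assume "x \<in> snd c ` W"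
    then have "chart_inv c x \<in> W" by (rule inW)
    then have "chart_inv c' (snd c' (chart_inv c x)) = chart_inv c x" "F (chart_inv c x) \<in> fst d'"
      using W *(5,6) chart_inv_left[OF ch(2)] by (auto simp: subset_eq)
    then show "snd d (chart_inv d' ((snd d' \<circ> F \<circ> chart_inv c') (snd c' (chart_inv c x))))
      = snd d (F (chart_inv c x))"
      using chart_inv_left[OF ch(4)] by simp
  qed
  with W that show ?thesis by blast
qed

lemma smooth_near_comp:
  assumes A: "smooth_manifold A" and B: "smooth_manifold B" and C: "smooth_manifold C"
    and F: "smooth_near A B F p" and G: "smooth_near B C G (F p)"
  shows "smooth_near A C (\<lambda>q. G (F q)) p"
proof -
  obtain c where c: "c \<in> A" "p \<in> fst c" using smooth_manifold_chart_at[OF A] .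
  obtain d where d: "d \<in> B" "F p \<in> fst d" using smooth_manifold_chart_at[OF B] .
  obtain e where e: "e \<in> C" "G (F p) \<in> fst e" using smooth_manifold_chart_at[OF C] .
  obtain W1 where W1: "open W1" "p \<in> W1" "W1 \<subseteq> fst c" "F ` W1 \<subseteq> fst d"
    "smooth_on (snd c ` W1) (\<lambda>x. snd d (F (chart_inv c x)))"
    using smooth_near_in_charts[OF A B F c d] .
  obtain W2 where W2: "open W2" "F p \<in> W2" "W2 \<subseteq> fst d" "G ` W2 \<subseteq> fst e"
    "smooth_on (snd d ` W2) (\<lambda>x. snd e (G (chart_inv d x)))"
    using smooth_near_in_charts[OF B C G d e] .
  obtain V where V: "open V" "p \<in> V" "continuous_on V F"
    using smooth_near_continuous[OF A B F] .
  note ch = smooth_manifold_is_chart[OF A c(1)] smooth_manifold_is_chart[OF B d(1)]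
  define W where "W = W1 \<inter> (V \<inter> F -` W2)"
  have "open W"
    unfolding W_def using W1 W2 V by (intro open_Int continuous_open_preimage) auto
  then have W: "open W" "p \<in> W" "W \<subseteq> W1" "F ` W \<subseteq> W2"
    using W1 W2 V by (auto simp: W_def)
  have Wc: "W \<subseteq> fst c" using W W1 by blast
  have oW: "open (snd c ` W)" by (rule open_chart_image[OF ch(1) W(1) Wc])
  have inW: "chart_inv c x \<in> W" if "x \<in> snd c ` W" for x
    using chart_inv_in_subset[OF ch(1) Wc that] .
  have "smooth_on (snd c ` W) (\<lambda>x. snd e (G (chart_inv d (snd d (F (chart_inv c x))))))"
    by (rule smooth_on_compose[OF oW open_chart_image[OF ch(2) W2(1,3)] W2(5) smooth_on_subset[OF W1(5)]])
      (use inW W in \<open>blast+\<close>)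
  then have "smooth_on (snd c ` W) (\<lambda>x. snd e (G (F (chart_inv c x))))"
    by (rule smooth_on_cong[OF oW])
      (use inW W(4) W2(3) chart_inv_left[OF ch(2)] in \<open>simp add: subset_eq\<close>)
  with c(1) e(1) W(1,2) Wc show ?thesis
    using W(4) W2(4) by (intro smooth_nearI) auto
qed

lemma smooth_near_cong:
  assumes A: "smooth_manifold A" and F: "smooth_near A B F p" and V: "open V" "p \<in> V"
    and eq: "\<And>q. q \<in> V \<Longrightarrow> F q = G q"
  shows "smooth_near A B G p"
proof -
  obtain c d W where *: "c \<in> A" "d \<in> B" "open W" "p \<in> W" "W \<subseteq> fst c" "F ` W \<subseteq> fst d"
    "smooth_on (snd c ` W) (snd d \<circ> F \<circ> chart_inv c)"
    using F unfolding smooth_near_def by blast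
  have c: "is_chart c" by (rule smooth_manifold_is_chart[OF A *(1)])
  have W: "open (W \<inter> V)" "W \<inter> V \<subseteq> fst c" using * V by auto
  have "smooth_on (snd c ` (W \<inter> V)) (\<lambda>x. snd d (F (chart_inv c x)))"
    by (rule smooth_on_subset[OF *(7)[unfolded o_def]]) auto
  then have "smooth_on (snd c ` (W \<inter> V)) (\<lambda>x. snd d (G (chart_inv c x)))"
    by (rule smooth_on_cong[OF open_chart_image[OF c W]])
      (use chart_inv_in_subset[OF c W(2)] eq in auto)
  then show ?thesis
    using * W V eq by (intro smooth_nearI[OF *(1,2) W(1)]) auto
qed

lemma chart_inv_real_line: "chart_inv (UNIV, id) = id"
  by (auto simp: chart_inv_def fun_eq_iff)

lemma smooth_manifold_real_line: "smooth_manifold real_line"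
proof -
  have "is_chart (UNIV::real set, id::real \<Rightarrow> real)"
    by (auto simp: is_chart_def homeomorphism_def intro!: exI[of _ id])
  then show ?thesis
    using smooth_on_id[of "UNIV :: real set"]
    by (auto simp: smooth_manifold_def real_line_def chart_inv_real_line fun_eq_iff o_def id_def chart_inv_real_line[unfolded id_def])
qed

lemma real_line_chart: "(UNIV, id) \<in> real_line"
  by (simp add: real_line_def)

lemma smooth_near_fun_in_chart:
  assumes A: "smooth_manifold A" and f: "smooth_near A real_line f p" and c: "c \<in> A" "p \<in> fst c"
  obtains W where "open W" "p \<in> W" "W \<subseteq> fst c" "smooth_on (snd c ` W) (\<lambda>x. f (chart_inv c x))"
proof -
  obtain W where "open W" "p \<in> W" "W \<subseteq> fst c"
    "smooth_on (snd c ` W) (\<lambda>x. snd (UNIV, id) (f (chart_inv c x)))"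
    by (rule smooth_near_in_charts[OF A smooth_manifold_real_line f c real_line_chart]) auto
  then show ?thesis using that by simp
qed

lemma smooth_near_funI:
  assumes "c \<in> A" "open W" "p \<in> W" "W \<subseteq> fst c" "smooth_on (snd c ` W) (\<lambda>x. f (chart_inv c x))"
  shows "smooth_near A real_line f p"
  by (rule smooth_nearI[OF assms(1) real_line_chart assms(2-4)]) (use assms(5) in auto)

lemma smooth_near_const:
  assumes A: "smooth_manifold A" and B: "smooth_manifold B"
  shows "smooth_near A B (\<lambda>_. b) p"
proof -
  obtain c where c: "c \<in> A" "p \<in> fst c" using smooth_manifold_chart_at[OF A] .
  obtain d where d: "d \<in> B" "b \<in> fst d" using smooth_manifold_chart_at[OF B] .
  have ch: "is_chart c" by (rule smooth_manifold_is_chart[OF A c(1)])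
  show ?thesis
    by (rule smooth_nearI[OF c(1) d(1) is_chart_open[OF ch] c(2)])
      (use d open_chart_image[OF ch is_chart_open[OF ch]] in \<open>auto intro: smooth_on_const\<close>)
qed

section \<open>Tangent vectors in coordinates\<close>

text \<open>The tangent vector with coordinates \<open>w\<close> in the chart \<open>c\<close>, the derivation $\sum_i w_i \partial_i$ at \<open>p\<close>. The
  next lemmas show that these are exactly the tangent vectors at \<open>p\<close>, which makes the tangent space a vector
  space and replaces velocities of curves by coordinates.\<close>

definition coord_vec :: "('a::topological_space, 'e::euclidean_space) atlas \<Rightarrow> ('a, 'e) chart \<Rightarrow>
    'a \<Rightarrow> 'e \<Rightarrow> 'a tvec" where
  "coord_vec A c p w = (\<lambda>f. if smooth_near A real_line f p
     then frechet_derivative (\<lambda>x. f (chart_inv c x)) (at (snd c p)) w else 0)"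

lemma smooth_near_fun_has_derivative:
  assumes "smooth_manifold A" "smooth_near A real_line f p" "c \<in> A" "p \<in> fst c"
  shows "((\<lambda>x. f (chart_inv c x)) has_derivative
    frechet_derivative (\<lambda>x. f (chart_inv c x)) (at (snd c p))) (at (snd c p))"
proof -
  obtain W where "open W" "p \<in> W" "W \<subseteq> fst c" "smooth_on (snd c ` W) (\<lambda>x. f (chart_inv c x))"
    using smooth_near_fun_in_chart[OF assms] .
  then show ?thesis by (intro smooth_on_has_derivative) auto
qed

lemma coord_vec_lincomb:
  assumes A: "smooth_manifold A" and c: "c \<in> A" "p \<in> fst c"
  shows "coord_vec A c p (a *\<^sub>R u + b *\<^sub>R v) = lincomb a (coord_vec A c p u) b (coord_vec A c p v)"
proof
  fix f
  show "coord_vec A c p (a *\<^sub>R u + b *\<^sub>R v) f = lincomb a (coord_vec A c p u) b (coord_vec A c p v) f"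
  proof (cases "smooth_near A real_line f p")
    case True
    have "linear (frechet_derivative (\<lambda>x. f (chart_inv c x)) (at (snd c p)))"
      using smooth_near_fun_has_derivative[OF A True c] has_derivative_linear by blast
    then show ?thesis
      using True by (simp add: coord_vec_def lincomb_def linear_add linear_scale)
  qed (simp add: coord_vec_def lincomb_def)
qed

lemma coord_vec_0:
  assumes A: "smooth_manifold A" and c: "c \<in> A" "p \<in> fst c"
  shows "coord_vec A c p 0 = tzero"
  using coord_vec_lincomb[OF assms, of 0 0 0 0] by (simp add: lincomb_def tzero_def)

lemma coord_vec_in_tangent_space:
  assumes A: "smooth_manifold A" and c: "c \<in> A" "p \<in> fst c"
  shows "coord_vec A c p w \<in> tangent_space A p"
proof -
  note ch = smooth_manifold_is_chart[OF A c(1)]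
  \<comment> \<open>A straight line in the chart has the required velocity.\<close>
  define \<gamma> where "\<gamma> t = chart_inv c (snd c p + t *\<^sub>R w)" for t :: real
  have g0: "\<gamma> 0 = p" using chart_inv_left[OF ch c(2)] by (simp add: \<gamma>_def)
  define W where "W = (\<lambda>t::real. snd c p + t *\<^sub>R w) -` (snd c ` fst c)"
  have oU: "open (snd c ` fst c)" by (rule open_chart_image[OF ch is_chart_open[OF ch]]) simp
  have W: "open W" "0 \<in> W"
    unfolding W_def using c by (auto intro!: open_vimage[OF oU] continuous_intros)
  have "smooth_near real_line A \<gamma> 0"
  proof (rule smooth_nearI[OF real_line_chart c(1) W])
    show "\<gamma> ` W \<subseteq> fst c" using chart_inv_in[of _ c] by (auto simp: W_def \<gamma>_def)
    have "smooth_on W (\<lambda>t. snd c p + t *\<^sub>R w)"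
      by (intro smooth_on_add smooth_on_scaleR smooth_on_const smooth_on_id W)
    then have "smooth_on W (\<lambda>t. snd c (\<gamma> t))"
      by (rule smooth_on_cong[OF W(1)]) (use chart_inv_right[of _ c] in \<open>auto simp: \<gamma>_def W_def\<close>)
    then show "smooth_on (snd (UNIV, id) ` W) (\<lambda>x. snd c (\<gamma> (chart_inv (UNIV, id) x)))"
      by (simp add: chart_inv_real_line)
  qed simp
  moreover have "deriv (\<lambda>t. f (\<gamma> t)) 0 = coord_vec A c p w f" if "smooth_near A real_line f p" for f
  proof -
    let ?D = "frechet_derivative (\<lambda>x. f (chart_inv c x)) (at (snd c p))"
    have D: "((\<lambda>x. f (chart_inv c x)) has_derivative ?D) (at (snd c p))"
      by (rule smooth_near_fun_has_derivative[OF A that c])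
    have 1: "((\<lambda>t::real. snd c p + t *\<^sub>R w) has_derivative (\<lambda>t. t *\<^sub>R w)) (at 0)"
      by (auto intro!: derivative_eq_intros)
    have "((\<lambda>t. f (\<gamma> t)) has_derivative (\<lambda>t. ?D (t *\<^sub>R w))) (at 0)"
      unfolding \<gamma>_def using has_derivative_compose[OF 1] D by simp
    then have "((\<lambda>t. f (\<gamma> t)) has_real_derivative ?D w) (at 0)"
      unfolding has_field_derivative_def
      using linear_scale[OF has_derivative_linear[OF D]] by (simp add: mult_commute_abs)
    then show ?thesis using that by (simp add: DERIV_imp_deriv coord_vec_def)
  qed
  ultimately show ?thesis
    unfolding tangent_space_def
    by (intro CollectI exI[of _ \<gamma>] conjI g0 ext) (auto simp: coord_vec_def)
qed

lemma tangent_space_coord_vec: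
  assumes A: "smooth_manifold A" and c: "c \<in> A" "p \<in> fst c" and v: "v \<in> tangent_space A p"
  obtains w where "v = coord_vec A c p w"
proof -
  note ch = smooth_manifold_is_chart[OF A c(1)]
  obtain \<gamma> where g: "smooth_near real_line A \<gamma> 0" "\<gamma> 0 = p"
    "v = (\<lambda>f. if smooth_near A real_line f p then deriv (\<lambda>t. f (\<gamma> t)) 0 else 0)"
    using v unfolding tangent_space_def by blast
  obtain W where W: "open W" "0 \<in> W" "\<gamma> ` W \<subseteq> fst c"
      "smooth_on (snd (UNIV, id) ` W) (\<lambda>x. snd c (\<gamma> (chart_inv (UNIV, id) x)))"
    by (rule smooth_near_in_charts[OF smooth_manifold_real_line A g(1) real_line_chart _ c(1)])
      (use g(2) c(2) in auto)
  have sm: "smooth_on W (\<lambda>t. snd c (\<gamma> t))" using W(4) by (simp add: chart_inv_real_line)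
  define G where "G = frechet_derivative (\<lambda>t. snd c (\<gamma> t)) (at 0)"
  have G: "((\<lambda>t. snd c (\<gamma> t)) has_derivative G) (at 0)"
    unfolding G_def by (rule smooth_on_has_derivative[OF sm W(2)])
  have "deriv (\<lambda>t. f (\<gamma> t)) 0 = coord_vec A c p (G 1) f" if "smooth_near A real_line f p" for f
  proof -
    let ?D = "frechet_derivative (\<lambda>x. f (chart_inv c x)) (at (snd c p))"
    have D: "((\<lambda>x. f (chart_inv c x)) has_derivative ?D) (at (snd c p))"
      by (rule smooth_near_fun_has_derivative[OF A that c])
    have "((\<lambda>t. f (chart_inv c (snd c (\<gamma> t)))) has_derivative (\<lambda>t. ?D (G t))) (at 0)"
      using has_derivative_compose[OF G] D g(2) by simp
    then have "((\<lambda>t. f (\<gamma> t)) has_derivative (\<lambda>t. ?D (G t))) (at 0)"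
      by (rule has_derivative_transform_within_open[OF _ W(1,2)])
        (use W(3) chart_inv_left[OF ch] in \<open>simp add: image_subset_iff\<close>)
    moreover have "(\<lambda>t. ?D (G t)) = (*) (?D (G 1))"
    proof
      fix t
      show "?D (G t) = ?D (G 1) * t"
      using linear_scale[OF has_derivative_linear[OF D], of t "G 1"]
        linear_scale[OF has_derivative_linear[OF G], of t 1] by simp
    qed
    ultimately have "((\<lambda>t. f (\<gamma> t)) has_real_derivative ?D (G 1)) (at 0)"
      unfolding has_field_derivative_def by (simp only:)
    then show ?thesis using that by (simp add: DERIV_imp_deriv coord_vec_def)
  qed
  note deriv_eq = this
  have "v f = coord_vec A c p (G 1) f" for f
    unfolding g(3) using deriv_eq[of f]
    by (cases "smooth_near A real_line f p") (simp_all add: coord_vec_def)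
  then show ?thesis by (intro that ext)
qed

lemma tangent_space_lincomb:
  assumes A: "smooth_manifold A" and "u \<in> tangent_space A p" "v \<in> tangent_space A p"
  shows "lincomb a u b v \<in> tangent_space A p"
proof -
  obtain c where c: "c \<in> A" "p \<in> fst c" using smooth_manifold_chart_at[OF A] .
  obtain x y where "u = coord_vec A c p x" "v = coord_vec A c p y"
    using assms(2,3) tangent_space_coord_vec[OF A c] by metis
  then show ?thesis
    by (metis coord_vec_lincomb[OF A c] coord_vec_in_tangent_space[OF A c])
qed

lemma tzero_in_tangent_space:
  assumes A: "smooth_manifold A"
  shows "tzero \<in> tangent_space A p"
proof -
  obtain c where c: "c \<in> A" "p \<in> fst c" using smooth_manifold_chart_at[OF A] .
  then show ?thesis
    using coord_vec_in_tangent_space[OF A c, of 0] coord_vec_0[OF A c] by simp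
qed

lemma differential_coord_vec:
  assumes A: "smooth_manifold A" and B: "smooth_manifold B" and F: "smooth_near A B F p"
    and c: "c \<in> A" "p \<in> fst c" and d: "d \<in> B" "F p \<in> fst d"
  shows "differential A B F p (coord_vec A c p w) = coord_vec B d (F p)
    (frechet_derivative (\<lambda>x. snd d (F (chart_inv c x))) (at (snd c p)) w)"
proof
  fix f
  show "differential A B F p (coord_vec A c p w) f = coord_vec B d (F p)
    (frechet_derivative (\<lambda>x. snd d (F (chart_inv c x))) (at (snd c p)) w) f"
  proof (cases "smooth_near B real_line f (F p)")
    case True
    note chc = smooth_manifold_is_chart[OF A c(1)] and chd = smooth_manifold_is_chart[OF B d(1)]
    obtain W where W: "open W" "p \<in> W" "W \<subseteq> fst c" "F ` W \<subseteq> fst d"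
      "smooth_on (snd c ` W) (\<lambda>x. snd d (F (chart_inv c x)))"
      using smooth_near_in_charts[OF A B F c d] .
    have p: "snd c p \<in> snd c ` W" "chart_inv c (snd c p) = p"
      using W(2) chart_inv_left[OF chc c(2)] by auto
    have 1: "((\<lambda>x. snd d (F (chart_inv c x))) has_derivative
        frechet_derivative (\<lambda>x. snd d (F (chart_inv c x))) (at (snd c p))) (at (snd c p))"
      by (rule smooth_on_has_derivative[OF W(5) p(1)])
    have "((\<lambda>x. f (chart_inv d (snd d (F (chart_inv c x))))) has_derivative
      (\<lambda>w. frechet_derivative (\<lambda>x. f (chart_inv d x)) (at (snd d (F p)))
        (frechet_derivative (\<lambda>x. snd d (F (chart_inv c x))) (at (snd c p)) w))) (at (snd c p))"
      using has_derivative_compose[OF 1] smooth_near_fun_has_derivative[OF B True d] p(2) by simp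
    then have "((\<lambda>x. f (F (chart_inv c x))) has_derivative
      (\<lambda>w. frechet_derivative (\<lambda>x. f (chart_inv d x)) (at (snd d (F p)))
        (frechet_derivative (\<lambda>x. snd d (F (chart_inv c x))) (at (snd c p)) w))) (at (snd c p))"
      by (rule has_derivative_transform_within_open[OF _ open_chart_image[OF chc W(1,3)] p(1)])
        (use W(4) chart_inv_left[OF chd] chart_inv_in_subset[OF chc W(3)] in \<open>simp add: image_subset_iff\<close>)
    from frechet_derivative_at[OF this] show ?thesis
      using True smooth_near_comp[OF A B smooth_manifold_real_line F True]
      by (simp add: differential_def coord_vec_def o_def fun_eq_iff)
  qed (simp add: differential_def coord_vec_def)
qed

lemma differential_in_tangent_space:
  assumes A: "smooth_manifold A" and B: "smooth_manifold B" and F: "smooth_near A B F p"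
    and v: "v \<in> tangent_space A p"
  shows "differential A B F p v \<in> tangent_space B (F p)"
proof -
  obtain c where c: "c \<in> A" "p \<in> fst c" using smooth_manifold_chart_at[OF A] .
  obtain d where d: "d \<in> B" "F p \<in> fst d" using smooth_manifold_chart_at[OF B] .
  obtain w where "v = coord_vec A c p w" using tangent_space_coord_vec[OF A c v] .
  then show ?thesis
    using differential_coord_vec[OF A B F c d] coord_vec_in_tangent_space[OF B d] by simp
qed

lemma differential_comp:
  assumes "smooth_manifold A" "smooth_manifold B" "smooth_manifold C"
    and "smooth_near A B F p" "smooth_near B C G (F p)"
  shows "differential A C (\<lambda>q. G (F q)) p v = differential B C G (F p) (differential A B F p v)"
  using smooth_near_comp[OF assms(2,3) smooth_manifold_real_line assms(5)]
  by (auto simp: differential_def fun_eq_iff o_def)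

lemma tangent_vector_const:
  assumes A: "smooth_manifold A" and v: "v \<in> tangent_space A p"
  shows "v (\<lambda>_. a) = 0"
proof -
  obtain c where c: "c \<in> A" "p \<in> fst c" using smooth_manifold_chart_at[OF A] .
  obtain w where "v = coord_vec A c p w" using tangent_space_coord_vec[OF A c v] .
  then show ?thesis by (simp add: coord_vec_def)
qed

text \<open>This applies to a leaf inclusion \<open>F\<close> into a product followed by a projection \<open>G\<close> to another factor: a
  vector tangent to one factor has zero components along the others. Where \<open>differential\<close> falls back on its
  default value, that value is zero as well.\<close>

lemma differential_of_constant_composite:
  assumes A: "smooth_manifold A" and v: "v \<in> tangent_space A p" and "\<And>q. G (F q) = b"
  shows "differential B C G (F p) (differential A B F p v) = tzero"
  using tangent_vector_const[OF A v] assms(3)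
  by (auto simp: differential_def fun_eq_iff o_def tzero_def)

section \<open>Product manifolds\<close>

lemma is_chart_prod:
  assumes c: "is_chart c" and d: "is_chart d"
  shows "is_chart (fst c \<times> fst d, map_prod (snd c) (snd d))"
proof -
  obtain k l where kl: "homeomorphism (fst c) (snd c ` fst c) (snd c) k"
    "homeomorphism (fst d) (snd d ` fst d) (snd d) l"
    using c d unfolding is_chart_def by blast
  have im: "map_prod (snd c) (snd d) ` (fst c \<times> fst d) = (snd c ` fst c) \<times> (snd d ` fst d)"
    by auto
  have cont: "continuous_on (S \<times> T) (map_prod f h)"
    if "continuous_on S f" "continuous_on T h"
    for S T and f :: "'x::topological_space \<Rightarrow> 'y::topological_space"
      and h :: "'z::topological_space \<Rightarrow> 'w::topological_space"
    unfolding map_prod_def case_prod_beta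
    by (intro continuous_on_Pair continuous_on_compose2[OF that(1)] continuous_on_compose2[OF that(2)]
        continuous_on_fst continuous_on_snd continuous_on_id) auto
  have "homeomorphism (fst c \<times> fst d) ((snd c ` fst c) \<times> (snd d ` fst d)) (map_prod (snd c) (snd d)) (map_prod k l)"
    unfolding homeomorphism_def
  proof (intro conjI)
    show "map_prod k l ` (snd c ` fst c \<times> snd d ` fst d) = fst c \<times> fst d"
      using kl by (auto simp: homeomorphism_def map_prod_surj_on)
  qed (use kl in \<open>auto simp: homeomorphism_def intro!: cont\<close>)
  then show ?thesis
    using c d im by (auto simp: is_chart_def open_Times)
qed

lemma chart_inv_prod:
  assumes c: "is_chart c" and d: "is_chart d" and x: "x \<in> snd c ` fst c" and y: "y \<in> snd d ` fst d"
  shows "chart_inv (fst c \<times> fst d, map_prod (snd c) (snd d)) (x, y) = (chart_inv c x, chart_inv d y)"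
proof -
  let ?e = "(fst c \<times> fst d, map_prod (snd c) (snd d))"
  have "(chart_inv c x, chart_inv d y) \<in> fst ?e" using chart_inv_in[OF x] chart_inv_in[OF y] by simp
  from chart_inv_left[OF is_chart_prod[OF c d] this] show ?thesis
    using chart_inv_right[OF x] chart_inv_right[OF y] by simp
qed

lemma smooth_on_fst: "open S \<Longrightarrow> smooth_on S (\<lambda>x. fst x)"
  by (rule smooth_on_bounded_linear[OF _ bounded_linear_fst smooth_on_id])

lemma smooth_on_snd: "open S \<Longrightarrow> smooth_on S (\<lambda>x. snd x)"
  by (rule smooth_on_bounded_linear[OF _ bounded_linear_snd smooth_on_id])

lemma smooth_manifold_prod:
  assumes A: "smooth_manifold A" and B: "smooth_manifold B"
  shows "smooth_manifold (prod_atlas A B)"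
proof -
  have "smooth_on (map_prod (snd c) (snd d) ` (fst c \<times> fst d \<inter> fst c' \<times> fst d'))
    (\<lambda>z. map_prod (snd c') (snd d') (chart_inv (fst c \<times> fst d, map_prod (snd c) (snd d)) z))"
    (is "smooth_on ?S _")
    if "c \<in> A" "d \<in> B" "c' \<in> A" "d' \<in> B" for c c' d d'
  proof -
    note ch = smooth_manifold_is_chart[OF A that(1)] smooth_manifold_is_chart[OF B that(2)]
      smooth_manifold_is_chart[OF A that(3)] smooth_manifold_is_chart[OF B that(4)]
    let ?U = "snd c ` (fst c \<inter> fst c')" and ?V = "snd d ` (fst d \<inter> fst d')"
    have S: "?S = ?U \<times> ?V" by auto
    have oU: "open ?U" "open ?V" by (intro open_chart_image open_Int is_chart_open ch; simp)+
    have oS: "open ?S" unfolding S using oU by (rule open_Times)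
    have "smooth_on ?S (\<lambda>z. snd c' (chart_inv c (fst z)))"
      by (rule smooth_on_compose[OF oS oU(1) smooth_manifold_transition[OF A that(1,3)] smooth_on_fst[OF oS]])
        (auto simp: S)
    moreover have "smooth_on ?S (\<lambda>z. snd d' (chart_inv d (snd z)))"
      by (rule smooth_on_compose[OF oS oU(2) smooth_manifold_transition[OF B that(2,4)] smooth_on_snd[OF oS]])
        (auto simp: S)
    ultimately have "smooth_on ?S (\<lambda>z. (snd c' (chart_inv c (fst z)), snd d' (chart_inv d (snd z))))"
      by (rule smooth_on_Pair[OF oS])
    then show ?thesis
      by (rule smooth_on_cong[OF oS]) (auto simp: chart_inv_prod[OF ch(1,2)])
  qed
  then have "smooth_on (snd c ` (fst c \<inter> fst d)) (snd d \<circ> chart_inv c)"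
    if "c \<in> prod_atlas A B" "d \<in> prod_atlas A B" for c d
    using that by (auto simp: prod_atlas_def o_def)
  moreover have "is_chart c" if "c \<in> prod_atlas A B" for c
    using that smooth_manifold_is_chart[OF A] smooth_manifold_is_chart[OF B]
    by (auto simp: prod_atlas_def intro!: is_chart_prod[of "(_, _)" "(_, _)", simplified])
  moreover have "\<exists>c\<in>prod_atlas A B. p \<in> fst c" for p
  proof -
    obtain c where "c \<in> A" "fst p \<in> fst c" using smooth_manifold_chart_at[OF A] .
    moreover obtain d where "d \<in> B" "snd p \<in> fst d" using smooth_manifold_chart_at[OF B] .
    ultimately show ?thesis
      unfolding prod_atlas_def by (intro bexI[OF _ imageI[of "(c, d)"]]) (auto simp: mem_Times_iff)
  qed
  ultimately show ?thesis unfolding smooth_manifold_def by blast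
qed

lemma prod_atlas_chart:
  "c \<in> A \<Longrightarrow> d \<in> B \<Longrightarrow> (fst c \<times> fst d, map_prod (snd c) (snd d)) \<in> prod_atlas A B"
  by (force simp: prod_atlas_def)

lemma smooth_near_fst:
  assumes A: "smooth_manifold A" and B: "smooth_manifold B"
  shows "smooth_near (prod_atlas A B) A fst p"
proof -
  obtain c where c: "c \<in> A" "fst p \<in> fst c" using smooth_manifold_chart_at[OF A] .
  obtain d where d: "d \<in> B" "snd p \<in> fst d" using smooth_manifold_chart_at[OF B] .
  note ch = smooth_manifold_is_chart[OF A c(1)] smooth_manifold_is_chart[OF B d(1)]
  have im: "map_prod (snd c) (snd d) ` (fst c \<times> fst d) = (snd c ` fst c) \<times> (snd d ` fst d)" by auto
  have oS: "open ((snd c ` fst c) \<times> (snd d ` fst d))"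
    using ch by (intro open_Times) (auto simp: is_chart_def)
  have "smooth_on ((snd c ` fst c) \<times> (snd d ` fst d))
    (\<lambda>x. snd c (fst (chart_inv (fst c \<times> fst d, map_prod (snd c) (snd d)) x)))"
    by (rule smooth_on_cong[OF oS smooth_on_fst[OF oS]])
      (auto simp: chart_inv_prod[OF ch] chart_inv_right chart_inv_left[OF ch(1)])
  then show ?thesis
    by (intro smooth_nearI[OF prod_atlas_chart[OF c(1) d(1)] c(1), of "fst c \<times> fst d"])
      (use c d ch im is_chart_open[OF ch(1)] is_chart_open[OF ch(2)] in \<open>auto simp: mem_Times_iff intro!: open_Times\<close>)
qed

lemma smooth_near_snd:
  assumes A: "smooth_manifold A" and B: "smooth_manifold B"
  shows "smooth_near (prod_atlas A B) B snd p"
proof -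
  obtain c where c: "c \<in> A" "fst p \<in> fst c" using smooth_manifold_chart_at[OF A] .
  obtain d where d: "d \<in> B" "snd p \<in> fst d" using smooth_manifold_chart_at[OF B] .
  note ch = smooth_manifold_is_chart[OF A c(1)] smooth_manifold_is_chart[OF B d(1)]
  have im: "map_prod (snd c) (snd d) ` (fst c \<times> fst d) = (snd c ` fst c) \<times> (snd d ` fst d)" by auto
  have oS: "open ((snd c ` fst c) \<times> (snd d ` fst d))"
    using ch by (intro open_Times) (auto simp: is_chart_def)
  have "smooth_on ((snd c ` fst c) \<times> (snd d ` fst d))
    (\<lambda>x. snd d (snd (chart_inv (fst c \<times> fst d, map_prod (snd c) (snd d)) x)))"
    by (rule smooth_on_cong[OF oS smooth_on_snd[OF oS]])
      (auto simp: chart_inv_prod[OF ch] chart_inv_right chart_inv_left[OF ch(2)])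
  then show ?thesis
    by (intro smooth_nearI[OF prod_atlas_chart[OF c(1) d(1)] d(1), of "fst c \<times> fst d"])
      (use c d ch im is_chart_open[OF ch(1)] is_chart_open[OF ch(2)] in \<open>auto simp: mem_Times_iff intro!: open_Times\<close>)
qed

lemma smooth_near_Pair:
  assumes A: "smooth_manifold A" and B: "smooth_manifold B" and C: "smooth_manifold C"
    and F: "smooth_near C A F p" and G: "smooth_near C B G p"
  shows "smooth_near C (prod_atlas A B) (\<lambda>q. (F q, G q)) p"
proof -
  obtain c where c: "c \<in> A" "F p \<in> fst c" using smooth_manifold_chart_at[OF A] .
  obtain d where d: "d \<in> B" "G p \<in> fst d" using smooth_manifold_chart_at[OF B] .
  obtain e where e: "e \<in> C" "p \<in> fst e" using smooth_manifold_chart_at[OF C] .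
  obtain W where W: "open W" "p \<in> W" "W \<subseteq> fst e" "F ` W \<subseteq> fst c"
    "smooth_on (snd e ` W) (\<lambda>x. snd c (F (chart_inv e x)))"
    using smooth_near_in_charts[OF C A F e c] .
  obtain V where V: "open V" "p \<in> V" "V \<subseteq> fst e" "G ` V \<subseteq> fst d"
    "smooth_on (snd e ` V) (\<lambda>x. snd d (G (chart_inv e x)))"
    using smooth_near_in_charts[OF C B G e d] .
  have WV: "open (W \<inter> V)" "p \<in> W \<inter> V" "W \<inter> V \<subseteq> fst e" using W V by auto
  have "open (snd e ` (W \<inter> V))"
    by (rule open_chart_image[OF smooth_manifold_is_chart[OF C e(1)] WV(1,3)])
  then have "smooth_on (snd e ` (W \<inter> V)) (\<lambda>x. (snd c (F (chart_inv e x)), snd d (G (chart_inv e x))))"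
    by (intro smooth_on_Pair smooth_on_subset[OF W(5)] smooth_on_subset[OF V(5)]) auto
  then show ?thesis
    by (intro smooth_nearI[OF e(1) prod_atlas_chart[OF c(1) d(1)] WV]) (use W V in auto)
qed

lemma smooth_near_id:
  assumes A: "smooth_manifold A"
  shows "smooth_near A A (\<lambda>q. q) p"
proof -
  obtain c where c: "c \<in> A" "p \<in> fst c" using smooth_manifold_chart_at[OF A] .
  note ch = smooth_manifold_is_chart[OF A c(1)]
  have o: "open (snd c ` fst c)" using ch by (simp add: is_chart_def)
  have "smooth_on (snd c ` fst c) (\<lambda>x. snd c (chart_inv c x))"
    by (rule smooth_on_cong[OF o smooth_on_id[OF o]]) (simp add: chart_inv_right)
  then show ?thesis
    by (intro smooth_nearI[OF c(1) c(1) is_chart_open[OF ch] c(2)]) auto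
qed

section \<open>Vector fields supported in a chart\<close>

text \<open>The coordinate field \<open>\<partial>\<^sub>w\<close> of the chart \<open>c\<close> multiplied by \<open>\<beta>\<close> and extended by zero. Connections act on
  globally defined vector fields, so a cutoff is needed to feed them coordinate fields.\<close>

definition coord_field :: "('a::topological_space, 'e::euclidean_space) atlas \<Rightarrow> ('a, 'e) chart \<Rightarrow>
    ('e \<Rightarrow> real) \<Rightarrow> 'e \<Rightarrow> 'a vfield" where
  "coord_field A c \<beta> w q = (if q \<in> fst c then coord_vec A c q (\<beta> (snd c q) *\<^sub>R w) else tzero)"

lemma coord_field_apply:
  assumes A: "smooth_manifold A" and c: "c \<in> A" "q \<in> fst c" and f: "smooth_near A real_line f q"
  shows "coord_field A c \<beta> w q f
    = \<beta> (snd c q) * frechet_derivative (\<lambda>x. f (chart_inv c x)) (at (snd c q)) w"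
  using linear_scale[OF has_derivative_linear[OF smooth_near_fun_has_derivative[OF A f c]]] c f
  by (simp add: coord_field_def coord_vec_def)

lemma coord_field_in_chart:
  assumes A: "smooth_manifold A" and c: "c \<in> A"
    and W: "open W" "W \<subseteq> fst c" "smooth_on (snd c ` W) (\<lambda>x. f (chart_inv c x))" "x \<in> snd c ` W"
  shows "coord_field A c \<beta> w (chart_inv c x) f = \<beta> x * frechet_derivative (\<lambda>x. f (chart_inv c x)) (at x) w"
proof -
  note ch = smooth_manifold_is_chart[OF A c]
  have q: "chart_inv c x \<in> W" by (rule chart_inv_in_subset[OF ch W(2,4)])
  have "smooth_near A real_line f (chart_inv c x)"
    by (rule smooth_near_funI[OF c W(1) q W(2,3)])
  moreover have "snd c (chart_inv c x) = x" using W(2,4) by (intro chart_inv_right) auto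
  ultimately show ?thesis using coord_field_apply[OF A c _ , of "chart_inv c x" f] q W(2) by auto
qed

lemma smooth_near_coord_field:
  assumes A: "smooth_manifold A" and c: "c \<in> A" "p \<in> fst c" and \<beta>: "smooth_on UNIV \<beta>"
    and f: "smooth_near A real_line f p"
  shows "smooth_near A real_line (\<lambda>q. coord_field A c \<beta> w q f) p"
proof -
  note ch = smooth_manifold_is_chart[OF A c(1)]
  obtain W where W: "open W" "p \<in> W" "W \<subseteq> fst c" "smooth_on (snd c ` W) (\<lambda>x. f (chart_inv c x))"
    using smooth_near_fun_in_chart[OF A f c] .
  have oW: "open (snd c ` W)" by (rule open_chart_image[OF ch W(1,3)])
  have "smooth_on (snd c ` W) (\<lambda>x. \<beta> x * frechet_derivative (\<lambda>x. f (chart_inv c x)) (at x) w)"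
    by (intro smooth_on_mult oW smooth_on_subset[OF \<beta>] smooth_on_frechet_derivative W(4)) simp
  then have "smooth_on (snd c ` W) (\<lambda>x. coord_field A c \<beta> w (chart_inv c x) f)"
    by (rule smooth_on_cong[OF oW]) (rule coord_field_in_chart[OF A c(1) W(1,3,4), symmetric])
  then show ?thesis by (rule smooth_near_funI[OF c(1) W(1-3)])
qed

text \<open>Outside the chart the field is zero near every point, because the preimage of the compact set \<open>K\<close> is
  compact, hence closed in the Hausdorff space \<open>'a\<close>.\<close>

lemma vector_field_coord_field:
  fixes A :: "('a::{t2_space, second_countable_topology}, 'e::euclidean_space) atlas"
  assumes A: "smooth_manifold A" and c: "c \<in> A" and \<beta>: "smooth_on UNIV \<beta>"
    and K: "compact K" "K \<subseteq> snd c ` fst c" "\<And>x. x \<notin> K \<Longrightarrow> \<beta> x = 0"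
  shows "vector_field A (coord_field A c \<beta> w)"
  unfolding vector_field_def smooth_map_def
proof (intro conjI allI impI)
  fix p
  show "coord_field A c \<beta> w p \<in> tangent_space A p"
    using coord_vec_in_tangent_space[OF A c] tzero_in_tangent_space[OF A] by (simp add: coord_field_def)
next
  note ch = smooth_manifold_is_chart[OF A c]
  fix f p assume f: "\<forall>p. smooth_near A real_line f p"
  show "smooth_near A real_line (\<lambda>q. coord_field A c \<beta> w q f) p"
  proof (cases "p \<in> fst c")
    case True
    then show ?thesis using f by (intro smooth_near_coord_field[OF A c _ \<beta>]) auto
  next
    case False
    have "compact (chart_inv c ` K)"
      by (rule compact_continuous_image[OF continuous_on_subset[OF continuous_on_chart_inv[OF ch] K(2)] K(1)])
    then have op: "open (- chart_inv c ` K)" by (simp add: compact_imp_closed open_Compl)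
    have p: "p \<in> - chart_inv c ` K" using False K(2) chart_inv_in[of _ c] by auto
    have zero: "0 = coord_field A c \<beta> w q f" if q: "q \<in> - chart_inv c ` K" for q
    proof (cases "q \<in> fst c")
      case True
      then have "snd c q \<notin> K" using q chart_inv_left[OF ch True] by (metis ComplD imageI)
      then show ?thesis
        using True K(3) coord_vec_0[OF A c True] by (simp add: coord_field_def tzero_def)
    qed (simp add: coord_field_def tzero_def)
    show ?thesis
      by (rule smooth_near_cong[OF A smooth_near_const[OF A smooth_manifold_real_line] op p zero])
  qed
qed

text \<open>$[\beta\partial_u, \beta\partial_v] = \beta(\partial_u\beta)\partial_v - \beta(\partial_v\beta)\partial_u$, because second
  derivatives commute, and both terms vanish at a critical point of \<open>\<beta>\<close>.\<close>

lemma lie_bracket_coord_field: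
  assumes A: "smooth_manifold A" and c: "c \<in> A" "p \<in> fst c" and \<beta>: "smooth_on UNIV \<beta>"
    and crit: "frechet_derivative \<beta> (at (snd c p)) = (\<lambda>_. 0)"
  shows "lie_bracket A (coord_field A c \<beta> u) (coord_field A c \<beta> v) p = tzero"
proof
  fix f
  show "lie_bracket A (coord_field A c \<beta> u) (coord_field A c \<beta> v) p f = tzero f"
  proof (cases "smooth_near A real_line f p")
    case True
    note ch = smooth_manifold_is_chart[OF A c(1)]
    let ?f = "\<lambda>x. f (chart_inv c x)"
    obtain W where W: "open W" "p \<in> W" "W \<subseteq> fst c" "smooth_on (snd c ` W) ?f"
      using smooth_near_fun_in_chart[OF A True c] .
    have oW: "open (snd c ` W)" by (rule open_chart_image[OF ch W(1,3)])
    have x0: "snd c p \<in> snd c ` W" using W(2) by simp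
    have "coord_field A c \<beta> u p (\<lambda>q. coord_field A c \<beta> v q f) = \<beta> (snd c p) * (\<beta> (snd c p) *
        frechet_derivative (\<lambda>x. frechet_derivative ?f (at x) v) (at (snd c p)) u)" for u v
    proof -
      have "((\<lambda>x. \<beta> x * frechet_derivative ?f (at x) v) has_derivative
          (\<lambda>u. \<beta> (snd c p) * frechet_derivative (\<lambda>x. frechet_derivative ?f (at x) v) (at (snd c p)) u
            + frechet_derivative \<beta> (at (snd c p)) u * frechet_derivative ?f (at (snd c p)) v)) (at (snd c p))"
        by (rule has_derivative_mult[OF smooth_on_has_derivative[OF \<beta> UNIV_I]
              smooth_on_has_derivative[OF smooth_on_frechet_derivative[OF W(4)] x0]])
      then have "((\<lambda>x. \<beta> x * frechet_derivative ?f (at x) v) has_derivative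
          (\<lambda>u. \<beta> (snd c p) * frechet_derivative (\<lambda>x. frechet_derivative ?f (at x) v) (at (snd c p)) u)) (at (snd c p))"
        by (simp add: crit)
      then have "((\<lambda>x. coord_field A c \<beta> v (chart_inv c x) f) has_derivative
          (\<lambda>u. \<beta> (snd c p) * frechet_derivative (\<lambda>x. frechet_derivative ?f (at x) v) (at (snd c p)) u)) (at (snd c p))"
        by (rule has_derivative_transform_within_open[OF _ oW x0])
          (rule coord_field_in_chart[OF A c(1) W(1,3,4), symmetric])
      from frechet_derivative_at[OF this] show ?thesis
        using coord_field_apply[OF A c smooth_near_coord_field[OF A c \<beta> True]] by metis
    qed
    then show ?thesis
      using True second_derivative_symmetric_real[OF oW x0 W(4), of u v]
      by (simp add: lie_bracket_def tzero_def)
  qed (simp add: lie_bracket_def tzero_def)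
qed

section \<open>The contact form of a Sasakian manifold\<close>

lemma riemannian_metric_sym:
  "riemannian_manifold A g \<Longrightarrow> u \<in> tangent_space A p \<Longrightarrow> v \<in> tangent_space A p \<Longrightarrow> g p u v = g p v u"
  unfolding riemannian_manifold_def by (elim conjE) blast

lemma riemannian_metric_lincomb:
  "riemannian_manifold A g \<Longrightarrow> u \<in> tangent_space A p \<Longrightarrow> v \<in> tangent_space A p \<Longrightarrow>
    w \<in> tangent_space A p \<Longrightarrow> g p (lincomb a u b v) w = a * g p u w + b * g p v w"
  unfolding riemannian_manifold_def by (elim conjE) blast

lemma riemannian_metric_tzero:
  assumes g: "riemannian_manifold A g" and v: "v \<in> tangent_space A p"
  shows "g p tzero v = 0" "g p v tzero = 0"
proof -
  have z: "tzero \<in> tangent_space A p"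
    using g tzero_in_tangent_space unfolding riemannian_manifold_def by blast
  have "g p (lincomb 0 tzero 0 tzero) v = 0 * g p tzero v + 0 * g p tzero v"
    by (rule riemannian_metric_lincomb[OF g z z v])
  then show "g p tzero v = 0" by (simp add: lincomb_def tzero_def)
  then show "g p v tzero = 0"
    using riemannian_metric_sym[OF g z v] by simp
qed

text \<open>Replacing \<open>u\<close> by \<open>\<phi> u\<close> in $g(\varphi u, \varphi v) = g(u,v) - \eta(u)\eta(v)$ and inserting the formula for
  $\varphi^2$ gives the skew symmetry.\<close>

lemma almost_contact_skew:
  assumes M: "almost_contact_metric_manifold A g \<phi> \<xi> \<eta>"
    and u: "u \<in> tangent_space A p" and v: "v \<in> tangent_space A p"
  shows "g p (\<phi> p u) v = - g p (\<phi> p v) u"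
proof -
  have phi: "\<phi> p u \<in> tangent_space A p" "\<phi> p v \<in> tangent_space A p" "\<xi> p \<in> tangent_space A p"
    using M u v unfolding almost_contact_metric_manifold_def tensor_field_1_1_def vector_field_def by auto
  have g: "riemannian_manifold A g" using M by (simp add: almost_contact_metric_manifold_def)
  note sym = riemannian_metric_sym[OF g] and lin = riemannian_metric_lincomb[OF g]
  have iso: "g p (\<phi> p x) (\<phi> p y) = g p x y - \<eta> p x * \<eta> p y"
    if "x \<in> tangent_space A p" "y \<in> tangent_space A p" for x y
    using M that unfolding almost_contact_metric_manifold_def by (elim conjE) blast
  have eta_g: "\<eta> p x = g p x (\<xi> p)" if "x \<in> tangent_space A p" for x
    using M that unfolding almost_contact_metric_manifold_def by (elim conjE) blast
  have eta_phi: "\<eta> p (\<phi> p x) = 0" if "x \<in> tangent_space A p" for x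
    using M that unfolding almost_contact_metric_manifold_def by (elim conjE) blast
  have sq: "\<phi> p (\<phi> p u) = lincomb (- 1) u (\<eta> p u) (\<xi> p)"
    using M u by (simp add: almost_contact_metric_manifold_def)
  have "g p (\<phi> p u) v = g p (\<phi> p (\<phi> p u)) (\<phi> p v)"
    using iso[OF phi(1) v] eta_phi[OF u] by simp
  also have "\<dots> = - g p u (\<phi> p v) + \<eta> p u * g p (\<xi> p) (\<phi> p v)"
    unfolding sq using lin[OF u phi(3,2)] by simp
  also have "\<dots> = - g p (\<phi> p v) u"
    using sym[OF u phi(2)] sym[OF phi(3,2)] eta_phi[OF v] eta_g[OF phi(2)] by simp
  finally show ?thesis .
qed

text \<open>The left-hand side is $d\eta(X,Y)$ at \<open>p\<close>, so the statement says $d\eta = -2 g(\varphi\cdot,\cdot)$. Since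
  $\eta = g(\cdot,\xi)$ and the connection is metric and torsion-free, $d\eta(X,Y)$ equals
  $g(\nabla_X\xi, Y) - g(\nabla_Y\xi, X)$. Now use $\nabla_X\xi = -\varphi X$ and the skew symmetry of $\varphi$.\<close>

lemma sasakian_contact_form_derivative:
  assumes M: "sasakian_manifold A g \<phi> \<xi> \<eta>" and X: "vector_field A X" and Y: "vector_field A Y"
  shows "X p (\<lambda>q. \<eta> q (Y q)) - Y p (\<lambda>q. \<eta> q (X q)) - \<eta> p (lie_bracket A X Y p)
    = - 2 * g p (\<phi> p (X p)) (Y p)"
proof -
  have ac: "almost_contact_metric_manifold A g \<phi> \<xi> \<eta>" using M by (simp add: sasakian_manifold_def)
  then have g: "riemannian_manifold A g" and xi: "vector_field A \<xi>" and phi: "tensor_field_1_1 A \<phi>"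
    and eta: "\<And>p u. u \<in> tangent_space A p \<Longrightarrow> \<eta> p u = g p u (\<xi> p)"
    and eta1: "one_form A \<eta>"
    by (auto simp: almost_contact_metric_manifold_def)
  obtain D where D: "levi_civita_connection A g D"
    "\<And>X p. vector_field A X \<Longrightarrow> D X \<xi> p = lincomb (- 1) (\<phi> p (X p)) 0 tzero"
    using M unfolding sasakian_manifold_def by blast
  have tan: "Z p \<in> tangent_space A p" if "vector_field A Z" for Z p
    using that by (simp add: vector_field_def)
  note sym = riemannian_metric_sym[OF g] and lin = riemannian_metric_lincomb[OF g]
  have A: "smooth_manifold A" using g by (simp add: riemannian_manifold_def)
  have D_field: "vector_field A (D X Y)" if "vector_field A X" "vector_field A Y" for X Y
    using D(1) that by (simp add: levi_civita_connection_def affine_connection_def)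
  have torsion_free: "lincomb 1 (D X Y p) (- 1) (D Y X p) = lie_bracket A X Y p"
    if "vector_field A X" "vector_field A Y" for X Y
    using D(1) that by (simp add: levi_civita_connection_def)
  have metric: "X p (\<lambda>q. g q (Y q) (Z q)) = g p (D X Y p) (Z p) + g p (Y p) (D X Z p)"
    if "vector_field A X" "vector_field A Y" "vector_field A Z" for X Y Z
    using D(1) that by (simp add: levi_civita_connection_def)
  have main: "X p (\<lambda>q. \<eta> q (Y q)) = \<eta> p (D X Y p) - g p (\<phi> p (X p)) (Y p)"
    if X: "vector_field A X" and Y: "vector_field A Y" for X Y
  proof -
    have DXY: "D X Y p \<in> tangent_space A p" by (rule tan[OF D_field[OF X Y]])
    have phX: "\<phi> p (X p) \<in> tangent_space A p"
      using phi tan[OF X] by (simp add: tensor_field_1_1_def)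
    have z: "tzero \<in> tangent_space A p" by (rule tzero_in_tangent_space[OF A])
    have "X p (\<lambda>q. \<eta> q (Y q)) = X p (\<lambda>q. g q (Y q) (\<xi> q))"
      using eta[OF tan[OF Y]] by simp
    also have "\<dots> = g p (D X Y p) (\<xi> p) + g p (Y p) (D X \<xi> p)"
      by (rule metric[OF X Y xi])
    also have "g p (Y p) (D X \<xi> p) = g p (D X \<xi> p) (Y p)"
      unfolding D(2)[OF X] by (rule sym[OF tan[OF Y] tangent_space_lincomb[OF A phX z]])
    also have "\<dots> = - g p (\<phi> p (X p)) (Y p)"
      unfolding D(2)[OF X] using lin[OF phX z tan[OF Y]] by simp
    finally show ?thesis using eta[OF DXY] by simp
  qed
  have DXY: "D X Y p \<in> tangent_space A p" "D Y X p \<in> tangent_space A p"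
    by (rule tan[OF D_field[OF X Y]], rule tan[OF D_field[OF Y X]])
  have "lie_bracket A X Y p = lincomb 1 (D X Y p) (- 1) (D Y X p)"
    by (rule torsion_free[OF X Y, symmetric])
  then have "\<eta> p (lie_bracket A X Y p) = \<eta> p (D X Y p) - \<eta> p (D Y X p)"
    using eta1 DXY unfolding one_form_def by simp
  then show ?thesis
    using main[OF X Y] main[OF Y X] almost_contact_skew[OF ac tan[OF X] tan[OF Y]] by simp
qed

section \<open>Submanifolds normal to the structure vector field\<close>

text \<open>If \<open>\<eta>\<close> vanishes on a submanifold, its pullback is zero, hence so is the pullback of
  $d\eta = -2 g(\varphi\cdot,\cdot)$: the submanifold is anti-invariant.

  The naturality of the exterior derivative behind this is verified in coordinates. Let \<open>J\<close> be the
  coordinate expression of \<open>F\<close>, \<open>\<beta>\<close> a bump function and \<open>h i\<close> the components of $\beta\eta$. The hypothesis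
  says $\sum_i \partial_s J_i \cdot h_i(J) = 0$. Its derivative along \<open>t\<close> is
  $\sum_i \partial_t\partial_s J_i \cdot h_i(J) + \sum_i \partial_s J_i \, \partial_{\partial_t J} h_i = 0$, and the first sum is
  symmetric in \<open>s\<close> and \<open>t\<close>. So is then the second sum \<open>H s t\<close>, and its skew part is, up to a
  nonzero constant, the value of $d\eta$ on the fields $\beta\partial_S$, $\beta\partial_T$ with $S = \partial_s J$,
  $T = \partial_t J$, whose bracket vanishes at the point.\<close>

lemma sasakian_integral_submanifold_anti_invariant:
  fixes A :: "('a::{t2_space, second_countable_topology}, 'e::euclidean_space) atlas"
  assumes M: "sasakian_manifold A g \<phi> \<xi> \<eta>" and N: "smooth_manifold N"
    and F: "smooth_map N A F"
    and ker: "\<And>z u. u \<in> sub_tangent_space N A F z \<Longrightarrow> \<eta> (F z) u = 0"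
    and u: "u \<in> sub_tangent_space N A F z\<^sub>0" and v: "v \<in> sub_tangent_space N A F z\<^sub>0"
  shows "g (F z\<^sub>0) (\<phi> (F z\<^sub>0) u) v = 0"
proof -
  have ac: "almost_contact_metric_manifold A g \<phi> \<xi> \<eta>" using M by (simp add: sasakian_manifold_def)
  then have g: "riemannian_manifold A g" and phi: "tensor_field_1_1 A \<phi>" and eta: "one_form A \<eta>"
    by (auto simp: almost_contact_metric_manifold_def)
  have A: "smooth_manifold A" using g by (simp add: riemannian_manifold_def)
  have Fs: "smooth_near N A F z" for z using F by (simp add: smooth_map_def)
  define p where "p = F z\<^sub>0"
  obtain c where c: "c \<in> A" "p \<in> fst c" using smooth_manifold_chart_at[OF A] .
  obtain e where e: "e \<in> N" "z\<^sub>0 \<in> fst e" using smooth_manifold_chart_at[OF N] .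
  note ch = smooth_manifold_is_chart[OF A c(1)] and che = smooth_manifold_is_chart[OF N e(1)]
  define J where "J a = snd c (F (chart_inv e a))" for a
  obtain W where W: "open W" "z\<^sub>0 \<in> W" "W \<subseteq> fst e" "F ` W \<subseteq> fst c" "smooth_on (snd e ` W) J"
    unfolding J_def using smooth_near_in_charts[OF N A Fs e c(1)] c(2) unfolding p_def by blast
  define a\<^sub>0 where "a\<^sub>0 = snd e z\<^sub>0"
  define x\<^sub>0 where "x\<^sub>0 = snd c p"
  have oW: "open (snd e ` W)" by (rule open_chart_image[OF che W(1,3)])
  have a0: "a\<^sub>0 \<in> snd e ` W" using W(2) by (simp add: a\<^sub>0_def)
  have J0: "J a\<^sub>0 = x\<^sub>0"
    using chart_inv_left[OF che e(2)] by (simp add: J_def a\<^sub>0_def x\<^sub>0_def p_def)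
  let ?DJ = "\<lambda>a s. frechet_derivative J (at a) s"
  have dF: "differential N A F (chart_inv e a) (coord_vec N e (chart_inv e a) s)
      = coord_vec A c (F (chart_inv e a)) (?DJ a s)" if "a \<in> snd e ` W" for a s
  proof -
    have z: "chart_inv e a \<in> W" by (rule chart_inv_in_subset[OF che W(3) that])
    have "snd e (chart_inv e a) = a" using that W(3) by (intro chart_inv_right) auto
    then show ?thesis
      using differential_coord_vec[OF N A Fs e(1) _ c(1), of "chart_inv e a" s] z W(3,4)
      by (auto simp: J_def[abs_def] image_subset_iff)
  qed
  have z0: "chart_inv e a\<^sub>0 = z\<^sub>0" using chart_inv_left[OF che e(2)] by (simp add: a\<^sub>0_def)
  have velocity: "\<exists>s. w = coord_vec A c p (?DJ a\<^sub>0 s)" if w: "w \<in> sub_tangent_space N A F z\<^sub>0" for w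
  proof -
    obtain w' where w': "w' \<in> tangent_space N z\<^sub>0" "w = differential N A F z\<^sub>0 w'"
      using w unfolding sub_tangent_space_def by blast
    obtain s where "w' = coord_vec N e z\<^sub>0 s" using tangent_space_coord_vec[OF N e w'(1)] .
    then show ?thesis using dF[OF a0, of s] w'(2) z0 by (auto simp: p_def)
  qed
  obtain s t where st: "u = coord_vec A c p (?DJ a\<^sub>0 s)" "v = coord_vec A c p (?DJ a\<^sub>0 t)"
    using velocity[OF u] velocity[OF v] by blast
  have oU: "open (snd c ` fst c)" and x0: "x\<^sub>0 \<in> snd c ` fst c" using ch c(2) by (auto simp: is_chart_def x\<^sub>0_def)
  obtain \<beta> :: "'e \<Rightarrow> real" and K where \<beta>: "smooth_on UNIV \<beta>" "\<beta> x\<^sub>0 \<noteq> 0" "frechet_derivative \<beta> (at x\<^sub>0) = (\<lambda>_. 0)"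
    "compact K" "K \<subseteq> snd c ` fst c" "\<forall>x. x \<notin> K \<longrightarrow> \<beta> x = 0"
    using bump_function_exists[OF oU x0] .
  let ?X = "coord_field A c \<beta>"
  have X: "vector_field A (?X w)" for w
    by (rule vector_field_coord_field[OF A c(1) \<beta>(1,4,5)]) (use \<beta>(6) in blast)
  define h where "h w q = \<eta> q (?X w q)" for w q
  have h_smooth: "smooth_near A real_line (h w) q" for w q
    using eta X unfolding h_def[abs_def] one_form_def smooth_map_def by blast
  have L: "linear (\<lambda>w. \<eta> q (coord_vec A c q w))" if q: "q \<in> fst c" for q
  proof -
    have *: "\<eta> q (coord_vec A c q (a *\<^sub>R u + b *\<^sub>R w)) = a * \<eta> q (coord_vec A c q u) + b * \<eta> q (coord_vec A c q w)"
      for a b u w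
      unfolding coord_vec_lincomb[OF A c(1) q]
      using eta coord_vec_in_tangent_space[OF A c(1) q] by (simp add: one_form_def)
    show ?thesis
      by (rule linearI) (use *[of 1 _ 1] *[of _ _ 0] in auto)
  qed
  have h_apply: "h w q = \<beta> (snd c q) * \<eta> q (coord_vec A c q w)" if "q \<in> fst c" for w q
    using linear_scale[OF L[OF that]] that by (simp add: h_def coord_field_def)
  define Dk where "Dk i = frechet_derivative (\<lambda>x. h i (chart_inv c x)) (at x\<^sub>0)" for i
  have Dk: "((\<lambda>x. h i (chart_inv c x)) has_derivative Dk i) (at x\<^sub>0)" for i
    unfolding Dk_def x\<^sub>0_def by (rule smooth_near_fun_has_derivative[OF A h_smooth c])
  \<comment> \<open>The pullback of $\beta\eta$ vanishes along the whole coordinate patch. The factor \<open>\<beta>\<close> is harmless here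
    and saves dividing by it.\<close>
  have vanish: "(\<Sum>i\<in>Basis. (?DJ a s \<bullet> i) * h i (chart_inv c (J a))) = 0" if a: "a \<in> snd e ` W" for a s
  proof -
    have z: "chart_inv e a \<in> W" by (rule chart_inv_in_subset[OF che W(3) a])
    let ?q = "F (chart_inv e a)"
    have q: "?q \<in> fst c" using z W(4) by auto
    have "(\<Sum>i\<in>Basis. (?DJ a s \<bullet> i) * h i (chart_inv c (J a)))
      = \<beta> (J a) * (\<Sum>i\<in>Basis. (?DJ a s \<bullet> i) *\<^sub>R \<eta> ?q (coord_vec A c ?q i))"
      using h_apply[OF q] chart_inv_left[OF ch q] by (simp add: J_def sum_distrib_left algebra_simps)
    also have "\<dots> = \<beta> (J a) * \<eta> ?q (coord_vec A c ?q (?DJ a s))"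
      using linear_euclidean_expand[OF L[OF q], of "?DJ a s"] by simp
    also have "coord_vec A c ?q (?DJ a s) \<in> sub_tangent_space N A F (chart_inv e a)"
      unfolding sub_tangent_space_def dF[OF a, symmetric]
      using coord_vec_in_tangent_space[OF N e(1)] z W(3) by blast
    then have "\<beta> (J a) * \<eta> ?q (coord_vec A c ?q (?DJ a s)) = 0" by (simp add: ker)
    finally show ?thesis .
  qed
  define H where "H s t = (\<Sum>i\<in>Basis. (?DJ a\<^sub>0 s \<bullet> i) * Dk i (?DJ a\<^sub>0 t))" for s t
  \<comment> \<open>Differentiate the vanishing pullback at \<open>a\<^sub>0\<close> in the direction \<open>t\<close>.\<close>
  have H: "H s t = - (\<Sum>i\<in>Basis. (frechet_derivative (\<lambda>a. ?DJ a s) (at a\<^sub>0) t \<bullet> i) * h i p)" for s t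
  proof -
    let ?D2 = "\<lambda>t. frechet_derivative (\<lambda>a. ?DJ a s) (at a\<^sub>0) t"
    have DJ: "(J has_derivative ?DJ a\<^sub>0) (at a\<^sub>0)" by (rule smooth_on_has_derivative[OF W(5) a0])
    have D2: "((\<lambda>a. ?DJ a s) has_derivative ?D2) (at a\<^sub>0)"
      by (rule smooth_on_has_derivative[OF smooth_on_frechet_derivative[OF W(5)] a0])
    have k: "((\<lambda>a. h i (chart_inv c (J a))) has_derivative (\<lambda>t. Dk i (?DJ a\<^sub>0 t))) (at a\<^sub>0)" for i
      using has_derivative_compose[OF DJ, of "\<lambda>x. h i (chart_inv c x)" "Dk i"] Dk[of i] J0 by simp
    have "((\<lambda>a. \<Sum>i\<in>Basis. (?DJ a s \<bullet> i) * h i (chart_inv c (J a))) has_derivative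
      (\<lambda>t. \<Sum>i\<in>Basis. (?DJ a\<^sub>0 s \<bullet> i) * Dk i (?DJ a\<^sub>0 t) + (?D2 t \<bullet> i) * h i (chart_inv c (J a\<^sub>0)))) (at a\<^sub>0)"
      by (intro has_derivative_sum has_derivative_mult k has_derivative_inner_left D2)
    moreover have "((\<lambda>a. \<Sum>i\<in>Basis. (?DJ a s \<bullet> i) * h i (chart_inv c (J a))) has_derivative (\<lambda>t. 0)) (at a\<^sub>0)"
      by (rule has_derivative_transform_within_open[OF has_derivative_const oW a0]) (simp add: vanish)
    ultimately have "(\<lambda>t. \<Sum>i\<in>Basis. (?DJ a\<^sub>0 s \<bullet> i) * Dk i (?DJ a\<^sub>0 t) + (?D2 t \<bullet> i) * h i (chart_inv c (J a\<^sub>0))) = (\<lambda>t. 0)"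
      by (rule has_derivative_unique)
    from fun_cong[OF this, of t] show ?thesis
      using chart_inv_left[OF ch c(2)] by (simp add: H_def sum.distrib J0 x\<^sub>0_def)
  qed
  have H_sym: "H s t = H t s"
    unfolding H using second_derivative_symmetric[OF oW a0 W(5)] by simp
  \<comment> \<open>\<open>h w'\<close> depends linearly on \<open>w'\<close>, so its derivatives are combinations of those of the components.\<close>
  have X_h: "?X w p (h w') = \<beta> x\<^sub>0 * (\<Sum>i\<in>Basis. (w' \<bullet> i) * Dk i w)" for w w'
  proof -
    have expand: "h w' (chart_inv c x) = (\<Sum>i\<in>Basis. (w' \<bullet> i) * h i (chart_inv c x))" if "x \<in> snd c ` fst c" for x
    proof -
      have q: "chart_inv c x \<in> fst c" by (rule chart_inv_in[OF that])
      show ?thesis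
        using linear_euclidean_expand[OF L[OF q], of w']
        by (simp add: h_apply[OF q] sum_distrib_left algebra_simps)
    qed
    have "((\<lambda>x. \<Sum>i\<in>Basis. (w' \<bullet> i) * h i (chart_inv c x)) has_derivative
        (\<lambda>w. \<Sum>i\<in>Basis. (w' \<bullet> i) * Dk i w)) (at x\<^sub>0)"
      by (intro has_derivative_sum has_derivative_mult_right Dk)
    then have "((\<lambda>x. h w' (chart_inv c x)) has_derivative (\<lambda>w. \<Sum>i\<in>Basis. (w' \<bullet> i) * Dk i w)) (at x\<^sub>0)"
      by (rule has_derivative_transform_within_open[OF _ oU x0]) (rule expand[symmetric])
    from fun_cong[OF frechet_derivative_at[OF this], of w] show ?thesis
      using coord_field_apply[OF A c h_smooth, of \<beta> w w', folded x\<^sub>0_def] by simp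
  qed
  let ?S = "?DJ a\<^sub>0 s" and ?T = "?DJ a\<^sub>0 t"
  have tan: "u \<in> tangent_space A p" "v \<in> tangent_space A p" "\<phi> p u \<in> tangent_space A p"
    unfolding st using coord_vec_in_tangent_space[OF A c] phi by (auto simp: tensor_field_1_1_def)
  have "lie_bracket A (?X ?S) (?X ?T) p = tzero"
    by (rule lie_bracket_coord_field[OF A c \<beta>(1)]) (use \<beta>(3) in \<open>simp add: x\<^sub>0_def\<close>)
  moreover have "\<eta> p tzero = 0"
    using linear_0[OF L[OF c(2)]] coord_vec_0[OF A c] by simp
  ultimately have "?X ?S p (h ?T) - ?X ?T p (h ?S) = - 2 * g p (\<phi> p (?X ?S p)) (?X ?T p)"
    using sasakian_contact_form_derivative[OF M X X, of ?S p ?T] by (simp add: h_def[abs_def])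
  moreover have "?X ?S p (h ?T) = ?X ?T p (h ?S)"
    using H_sym unfolding X_h H_def by simp
  ultimately have "g p (\<phi> p (?X ?S p)) (?X ?T p) = 0" by simp
  \<comment> \<open>At \<open>p\<close> the two fields are the given tangent vectors scaled by the nonzero number \<open>\<beta> x\<^sub>0\<close>.\<close>
  moreover have "?X ?S p = lincomb (\<beta> x\<^sub>0) u 0 u" "?X ?T p = lincomb (\<beta> x\<^sub>0) v 0 v"
    using coord_vec_lincomb[OF A c, of "\<beta> x\<^sub>0" ?S 0 ?S] coord_vec_lincomb[OF A c, of "\<beta> x\<^sub>0" ?T 0 ?T] c(2)
    by (simp_all add: coord_field_def st x\<^sub>0_def)
  moreover have "\<phi> p (lincomb (\<beta> x\<^sub>0) u 0 u) = lincomb (\<beta> x\<^sub>0) (\<phi> p u) 0 (\<phi> p u)"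
    using phi tan unfolding tensor_field_1_1_def by blast
  moreover have "g p (lincomb (\<beta> x\<^sub>0) (\<phi> p u) 0 (\<phi> p u)) (lincomb (\<beta> x\<^sub>0) v 0 v)
    = \<beta> x\<^sub>0 * (\<beta> x\<^sub>0 * g p (\<phi> p u) v)"
  proof -
    note sym = riemannian_metric_sym[OF g] and lin = riemannian_metric_lincomb[OF g]
    have v': "lincomb (\<beta> x\<^sub>0) v 0 v \<in> tangent_space A p" by (rule tangent_space_lincomb[OF A tan(2,2)])
    have "g p (lincomb (\<beta> x\<^sub>0) (\<phi> p u) 0 (\<phi> p u)) (lincomb (\<beta> x\<^sub>0) v 0 v)
      = \<beta> x\<^sub>0 * g p (\<phi> p u) (lincomb (\<beta> x\<^sub>0) v 0 v)"
      using lin[OF tan(3,3) v'] by simp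
    also have "\<dots> = \<beta> x\<^sub>0 * g p (lincomb (\<beta> x\<^sub>0) v 0 v) (\<phi> p u)" using sym[OF tan(3) v'] by simp
    also have "\<dots> = \<beta> x\<^sub>0 * (\<beta> x\<^sub>0 * g p (\<phi> p u) v)"
      using lin[OF tan(2,2,3)] sym[OF tan(3,2)] by simp
    finally show ?thesis .
  qed
  ultimately have "g p (\<phi> p u) v = 0" using \<beta>(2) by simp
  then show ?thesis by (simp add: p_def)
qed

section \<open>CRS bi-warped products\<close>

text \<open>The bi-warped metric is a sum of metrics pulled back from the three factors. A vector tangent to the
  third factor is killed by the first two projections and a vector tangent to the first factor by the third,
  so each summand has a zero argument.\<close>

lemma biwarped_leaves_orthogonal:
  fixes A :: "('a::{t2_space, second_countable_topology}, 'e::euclidean_space) atlas"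
    and B :: "('b::{t2_space, second_countable_topology}, 'eb::euclidean_space) atlas"
    and N1 :: "('c::{t2_space, second_countable_topology}, 'ec::euclidean_space) atlas"
    and N2 :: "('d::{t2_space, second_countable_topology}, 'ed::euclidean_space) atlas"
  assumes A: "smooth_manifold A"
    and W: "biwarped_product_submanifold A g B gB N1 g1 N2 g2 f1 f2 \<iota>"
    and u: "u \<in> sub_tangent_space N2 A (\<lambda>z. \<iota> (x, y, z)) z"
    and v: "v \<in> sub_tangent_space B A (\<lambda>x. \<iota> (x, y, z)) x"
  shows "g (\<iota> (x, y, z)) u v = 0"
proof -
  let ?P = "prod3_atlas B N1 N2"
  have r: "riemannian_manifold B gB" "riemannian_manifold N1 g1" "riemannian_manifold N2 g2"
    using W by (auto simp: biwarped_product_submanifold_def)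
  then have B: "smooth_manifold B" and N1: "smooth_manifold N1" and N2: "smooth_manifold N2"
    by (auto simp: riemannian_manifold_def)
  note N12 = smooth_manifold_prod[OF N1 N2]
  note P = smooth_manifold_prod[OF B N12]
  have i: "smooth_near ?P A \<iota> q" for q
    using W unfolding biwarped_product_submanifold_def immersion_def smooth_map_def
    by (elim conjE) blast
  have i2: "smooth_near N2 ?P (\<lambda>z. (x, y, z)) z"
    by (intro smooth_near_Pair smooth_near_const smooth_near_id B N1 N2 N12)
  have iB: "smooth_near B ?P (\<lambda>x. (x, y, z)) x"
    by (intro smooth_near_Pair[OF B N12 B] smooth_near_const smooth_near_id B N12)
  obtain u' where u': "u' \<in> tangent_space N2 z" "u = differential N2 A (\<lambda>z. \<iota> (x, y, z)) z u'"
    using u by (auto simp: sub_tangent_space_def)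
  obtain v' where v': "v' \<in> tangent_space B x" "v = differential B A (\<lambda>x. \<iota> (x, y, z)) x v'"
    using v by (auto simp: sub_tangent_space_def)
  define U where "U = differential N2 ?P (\<lambda>z. (x, y, z)) z u'"
  define V where "V = differential B ?P (\<lambda>x. (x, y, z)) x v'"
  have UV: "u = differential ?P A \<iota> (x, y, z) U" "v = differential ?P A \<iota> (x, y, z) V"
    unfolding u' v' U_def V_def
    using differential_comp[OF N2 P A i2 i] differential_comp[OF B P A iB i] by auto
  have tan: "U \<in> tangent_space ?P (x, y, z)" "V \<in> tangent_space ?P (x, y, z)"
    unfolding U_def V_def
    using differential_in_tangent_space[OF N2 P i2 u'(1)] differential_in_tangent_space[OF B P iB v'(1)] by auto
  have s1: "smooth_near ?P B fst q" for q by (rule smooth_near_fst[OF B N12])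
  have s2: "smooth_near ?P N1 (fst \<circ> snd) q" for q
    unfolding o_def by (rule smooth_near_comp[OF P N12 N1 smooth_near_snd[OF B N12] smooth_near_fst[OF N1 N2]])
  have s3: "smooth_near ?P N2 (snd \<circ> snd) q" for q
    unfolding o_def by (rule smooth_near_comp[OF P N12 N2 smooth_near_snd[OF B N12] smooth_near_snd[OF N1 N2]])
  have z: "differential ?P B fst (x, y, z) U = tzero"
    "differential ?P N1 (fst \<circ> snd) (x, y, z) U = tzero"
    "differential ?P N2 (snd \<circ> snd) (x, y, z) V = tzero"
    unfolding U_def V_def
    using differential_of_constant_composite[OF N2 u'(1), of fst "\<lambda>z. (x, y, z)" x]
      differential_of_constant_composite[OF N2 u'(1), of "fst \<circ> snd" "\<lambda>z. (x, y, z)" y]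
      differential_of_constant_composite[OF B v'(1), of "snd \<circ> snd" "\<lambda>x. (x, y, z)" z]
    by simp_all
  have t: "differential ?P B fst (x, y, z) V \<in> tangent_space B x"
    "differential ?P N1 (fst \<circ> snd) (x, y, z) V \<in> tangent_space N1 y"
    "differential ?P N2 (snd \<circ> snd) (x, y, z) U \<in> tangent_space N2 z"
    using differential_in_tangent_space[OF P B s1 tan(2)] differential_in_tangent_space[OF P N1 s2 tan(2)]
      differential_in_tangent_space[OF P N2 s3 tan(1)] by auto
  have "g (\<iota> (x, y, z)) u v = induced_metric ?P A g \<iota> (x, y, z) U V"
    by (simp add: induced_metric_def UV)
  also have "\<dots> = biwarped_metric B gB N1 g1 N2 g2 f1 f2 (x, y, z) U V"
    using W tan unfolding biwarped_product_submanifold_def by blast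
  also have "\<dots> = 0"
    using riemannian_metric_tzero[OF r(1) t(1)] riemannian_metric_tzero[OF r(2) t(2)]
      riemannian_metric_tzero[OF r(3) t(3)]
    by (simp add: biwarped_metric_def Let_def z)
  finally show ?thesis .
qed

theorem proposition3p1:
  fixes A :: "('a::{t2_space, second_countable_topology}, 'e::euclidean_space) atlas"
    and g :: "'a metric"
    and \<phi> :: "'a \<Rightarrow> 'a tvec \<Rightarrow> 'a tvec"
    and \<xi> :: "'a vfield"
    and \<eta> :: "'a \<Rightarrow> 'a tvec \<Rightarrow> real"
    and NT :: "('b::{t2_space, second_countable_topology}, 'eb::euclidean_space) atlas"
    and gT :: "'b metric"
    and Nperp :: "('c::{t2_space, second_countable_topology}, 'ec::euclidean_space) atlas"
    and gperp :: "'c metric"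
    and Nslant :: "('d::{t2_space, second_countable_topology}, 'ed::euclidean_space) atlas"
    and gslant :: "'d metric"
    and f1 f2 :: "'b \<Rightarrow> real"
    and \<iota> :: "'b \<times> 'c \<times> 'd \<Rightarrow> 'a"
  assumes "sasakian_manifold A g \<phi> \<xi> \<eta>"
    and "CRS_biwarped_product A g \<phi> \<xi> NT gT Nperp gperp Nslant gslant f1 f2 \<iota>"
  shows "contact_CR_biwarped_product A g \<phi> \<xi> NT gT Nperp gperp Nslant gslant f1 f2 \<iota>"
proof -
  have ac: "almost_contact_metric_manifold A g \<phi> \<xi> \<eta>"
    using assms(1) by (simp add: sasakian_manifold_def)
  then have A: "smooth_manifold A" and phi: "tensor_field_1_1 A \<phi>"
    by (auto simp: almost_contact_metric_manifold_def riemannian_manifold_def)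
  have W: "biwarped_product_submanifold A g NT gT Nperp gperp Nslant gslant f1 f2 \<iota>"
    and inv: "\<And>y z. invariant_submanifold NT A \<phi> \<xi> (\<lambda>x. \<iota> (x, y, z))"
    and slant: "\<And>x y. pointwise_slant_submanifold Nslant A g \<phi> (\<lambda>z. \<iota> (x, y, z))"
    using assms(2) by (auto simp: CRS_biwarped_product_def)
  have N: "smooth_manifold Nslant"
    using W by (simp add: biwarped_product_submanifold_def riemannian_manifold_def)
  have "anti_invariant_submanifold Nslant A g \<phi> (\<lambda>z. \<iota> (x, y, z))" for x y
  proof -
    let ?j = "\<lambda>z. \<iota> (x, y, z)"
    have im: "immersion Nslant A ?j" using slant by (simp add: pointwise_slant_submanifold_def)
    have j: "smooth_map Nslant A ?j" using im by (simp add: immersion_def)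
    have tan: "u \<in> tangent_space A (?j z)" if "u \<in> sub_tangent_space Nslant A ?j z" for u z
      using that differential_in_tangent_space[OF N A] j
      by (auto simp: sub_tangent_space_def smooth_map_def)
    have ker: "\<eta> (?j z) u = 0" if u: "u \<in> sub_tangent_space Nslant A ?j z" for u z
    proof -
      have "\<xi> (?j z) \<in> sub_tangent_space NT A (\<lambda>x. \<iota> (x, y, z)) x"
        using inv by (simp add: invariant_submanifold_def)
      then have "g (?j z) u (\<xi> (?j z)) = 0" by (rule biwarped_leaves_orthogonal[OF A W u])
      then show ?thesis
        using ac tan[OF u] by (simp add: almost_contact_metric_manifold_def)
    qed
    have "\<phi> (?j z) u \<in> sub_normal_space Nslant A g ?j z" if u: "u \<in> sub_tangent_space Nslant A ?j z" for u z
      using sasakian_integral_submanifold_anti_invariant[OF assms(1) N j ker u] tan[OF u] phi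
      by (auto simp: sub_normal_space_def tensor_field_1_1_def)
    then show ?thesis using im by (auto simp: anti_invariant_submanifold_def)
  qed
  then show ?thesis
    using assms(2) by (simp add: CRS_biwarped_product_def contact_CR_biwarped_product_def)
qed

end
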